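(* Under the standing assumptions (i)–(vii) of the context, a normal extremum for the discrete-time optimal control problem $$\min_{(g^k,u^k)}\sum_{i=1}^s\sum_{k=0}^{N-1}h\big(C_i(g_i^k,u_i^k)+V_i^0(g_i^k)+V_i(g^k)\big)$$ subject to $g_i^{k+1}=g_i^k\mathcal R(hu_i^k)$ with given boundary conditions $g^0$ and $g^N$ satisfies, for each $i=1,\dots,s$ and $k=1,\dots,N-1$, the equations $$g_i^{k+1}=g_i^k\mathcal R(hu_i^k),$$ $$\big(d\mathcal R^{-1}_{(hu_i^k)}\big)^*\mu_i^k=\big(d\mathcal R^{-1}_{(-hu_i^{k-1})}\big)^*\mu_i^{k-1}+\mathbf J_V\Big(h\frac{\partial V_i^{0,\mathrm{ext}}}{\partial\bar\alpha_i^k},\bar\alpha_i^k\Big)+h\,\Theta^i_1\sum_{l=1}^sT^*_{\bar e_i}L_{g_i^k}\Big(\frac{\partial V_l}{\partial g_i^k}\Big),$$ $$\mu_i^k=\frac{\partial C_i}{\partial u_i^k},$$ $$\bar\alpha_i^{k+1}=\rho^*_{\mathcal R(hu_i^k)}(\bar\alpha_i^k),\qquad\bar\alpha_i^0=\rho^*_{g_i^0}(\alpha_i^0),$$ where $\Theta^i_1=0$ if $i=1$ and $\Theta^i_1=1$ otherwise.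
   Context: Agents. $\mathcal N=\{1,\dots,s\}$, $s\ge2$, is a set of agents; interactions are given by a static connected undirected graph $(\mathcal N,\mathcal E)$, $\mathcal E\subset\mathcal N\times\mathcal N$, with $\mathcal N_i=\{j\in\mathcal N:(i,j)\in\mathcal E\}$. Each agent evolves on the same $n$-dimensional Lie group $G$ with Lie algebra $\mathfrak g$ and identity $\bar e$ (denoted $\bar e_i$ for agent $i$). $L_g(h)=gh$, and $T^*_hL_g:T^*_{gh}G\to T^*_hG$ is the dual of the tangent map $T_hL_g$. The continuous-time kinematics is $\dot g_i=T_{\bar e_i}L_{g_i}(u_i)$. Discretization. $T>0$ is fixed, $N$ is the number of steps, $h=T/N>0$; a discrete trajectory of agent $i$ is $g_i^0,\dots,g_i^N\in G$ with discrete controls $u_i^k\in\mathfrak g$; $g^k=(g_1^k,\dots,g_s^k)$, $u^k=(u_1^k,\dots,u_s^k)$. The boundary data $g^0$, $g^N$ are given, and so are $u_i(0)$, $u_i(T)$. A retraction map $\mathcal R:\mathfrak g\to G$ is an analytic local diffeomorphism assigning a neighborhood of $0\in\mathfrak g$ to a neighborhood of $\bar e\in G$ (with $\mathcal R(0)=\bar e$). Its right-trivialized tangent $d\mathcal R_\xi:\mathfrak g\to\mathfrak g$ is defined by $T\mathcal R(\xi)\cdot\eta=TR_{\mathcal R(\xi)}\,d\mathcal R_\xi(\eta)$, where $R$ is right translation on $G$; $d\mathcal R^{-1}_\xi$ is the inverse of $d\mathcal R_\xi$ and $(d\mathcal R^{-1}_\xi)^*:\mathfrak g^*\to\mathfrak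 g^*$ its dual. Representations. $\rho$ is a left representation of $G$ on a finite-dimensional vector space $V$; $\langle\rho^*_g(\alpha),v\rangle=\langle\alpha,\rho_g(v)\rangle$; $\rho'(\xi,v)=\frac{d}{dt}\big|_{t=0}\rho_{\exp(t\xi)}(v)$; the momentum map $\mathbf J_V:V\times V^*\to\mathfrak g^*$ is $\langle\mathbf J_V(v,\alpha),\xi\rangle=\langle\alpha,\rho'(\xi,v)\rangle$ for all $\xi\in\mathfrak g$. Standing assumptions. (i) There is a left representation $\rho$ of $G$ on $V$. (ii) $C_i:G\times\mathfrak g\to\mathbb R$ is differentiable almost everywhere and $G$-invariant: $C_i(gh,u)=C_i(h,u)$ for all $g,h\in G$, $u\in\mathfrak g$. (iii) $V_{ij}:G\times G\to\mathbb R$ (collision avoidance potentials) satisfy $V_{ij}=V_{ji}$, are differentiable almost everywhere, and $V_{ij}(gg_i,gg_j)=V_{ij}(g_i,g_j)$ for all $g\in G$, $j\in\mathcal N_i$. Put $V_i(g)=\frac12\sum_{j\in\mathcal N_i}V_{ij}(g_i,g_j)$. (iv) $V_i^0:G\to\mathbb R$ (obstacle avoidance potentials) are differentiable almost everywhere and not $G$-invariant. (v) $V_i^0$ depends on a parameter $\alpha_0\in V^*$ (written $\alpha_i^0$ for agent $i$ in the discrete setting), and there is an extended potential $V_i^{0,\mathrm{ext}}:G\times V^*\to\mathbb R$ with $V_i^{0,\mathrm{ext}}(\cdot,\alpha_0)=V_i^0$. (vi) $V_i^{0,\mathrm{ext}}(gh,\rho^*_{g^{-1}}(\alpha))=V_i^{0,\mathrm{ext}}(h,\alpha)$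 for all $g,h\in G$, $\alpha\in V^*$. (vii) $V_i^0$ is invariant under the left action of the isotropy group $G_{\alpha_0}=\{g\in G:\rho^*_g(\alpha_0)=\alpha_0\}$. In addition each agent occupies a disk of radius $\bar r$ on $G$, small enough that all agents can be packed on $G$; the potentials are well defined and feasible when the distance between agents exceeds $2\bar r$. Discrete constrained variational problem. With multipliers $\mu_i^k\in\mathfrak g^*$ and $\xi_i^{k,k+1}=(g_i^k)^{-1}g_i^{k+1}$, the augmented discrete Lagrangian is $$\mathcal L_d(g^k,g^{k+1},u^k,\mu^k)=h\sum_{i=1}^s\Big(C_i(g_i^k,u_i^k)+V_i^0(g_i^k)+V_i(g^k)+\Big\langle\mu_i^k,\tfrac1h\mathcal R^{-1}(\xi_i^{k,k+1})-u_i^k\Big\rangle\Big).$$ Normal extrema are the extrema of this constrained variational problem in which the cost enters with multiplier normalized to $1$: $\delta\sum_{k=0}^{N-1}\mathcal L_d(g^k,g^{k+1},u^k,\mu^k)=0$ for all variations of $g^k$ vanishing at the endpoints, of $\mathcal R^{-1}(\xi^{k,k+1})$ (induced by variations of $g^k$), and of $u^k$, together with the constraint and boundary conditions. Reduced notation. By invariance one writes $C_i(u_i^k):=C_i(\bar e_i,u_i^k)$, $V_i^{0,\mathrm{ext}}(\alpha):=V_i^{0,\mathrm{ext}}(\bar e_i,\alpha)$ and $\bar\alpha_i^k=\rho^*_{g_i^k}(\alpha_i^0)$; $\partial V_i^{0,\mathrm{ext}}/\partial\bar\alpha_i^k\in V$ is the derivative of $\alpha\mapsto V_i^{0,\mathrm{ext}}(\bar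 e_i,\alpha)$ at $\bar\alpha_i^k$. In the reduced augmented discrete Lagrangian $\ell_{ext,d}(g^k,\xi^{k,k+1},u^k,\mu^k,\bar\alpha^k)=h\sum_{i=1}^s\big(C_i(u_i^k)+V_i^{0,\mathrm{ext}}(\bar\alpha_i^k)+\langle\mu_i^k,\frac1h\mathcal R^{-1}(\xi_i^{k,k+1})-u_i^k\rangle+V_i(g^k)\big)$, with a slight abuse of notation, $g_1^k$ is set to be the identity, so that $g^k=(g_2^k,\dots,g_s^k)\in G^{s-1}$; the equations are written in this reduced notation.
   Formalization: R(ξ)R(−ξ)=e is added (false otherwise); the equations with Θ are proved for extrema of the reduced Lagrangian with g_1^k=ē in V_i; for extrema of L_d the collision term stays for i=1, where dropping it is false; derivatives occurring in the equations are assumed to exist. *)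

theory Defs
  imports "HOL-Analysis.Analysis" "HOL-Algebra.Group"
begin

text \<open>\<open>C_k k f S\<close>: \<open>f\<close> is \<open>k\<close> times continuously differentiable on the open set \<open>S\<close>.
  The derivative is handled through its directional components \<open>\<lambda>x. D x v\<close>.\<close>

primrec C_k :: "nat \<Rightarrow> ('a::real_normed_vector \<Rightarrow> 'b::real_normed_vector) \<Rightarrow> 'a set \<Rightarrow> bool" where
  "C_k 0 f S \<longleftrightarrow> continuous_on S f"
| "C_k (Suc k) f S \<longleftrightarrow>
     (\<exists>D. (\<forall>x\<in>S. (f has_derivative D x) (at x)) \<and> (\<forall>v. C_k k (\<lambda>x. D x v) S))"

definition smooth_on :: "('a::real_normed_vector \<Rightarrow> 'b::real_normed_vector) \<Rightarrow> 'a set \<Rightarrow> bool" where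
  "smooth_on f S \<longleftrightarrow> open S \<and> (\<forall>k. C_k k f S)"

text \<open>Locally a convergent power series in the coordinates; the sum runs over the multi-indices
  \<open>m\<close>, that is, functions vanishing outside \<^term>\<open>Basis\<close>. Smoothness is implied by
  the expansion, and recorded for convenience.\<close>

definition real_analytic_on ::
    "('a::euclidean_space \<Rightarrow> 'b::real_normed_vector) \<Rightarrow> 'a set \<Rightarrow> bool" where
  "real_analytic_on f S \<longleftrightarrow> smooth_on f S \<and>
     (\<forall>x\<in>S. \<exists>r>0. \<exists>c. \<forall>v. norm v < r \<longrightarrow>
        ((\<lambda>m::'a \<Rightarrow> nat. (\<Prod>b\<in>Basis. (v \<bullet> b) ^ m b) *\<^sub>R c m) has_sum f (x + v))
          {m. \<forall>b. b \<notin> Basis \<longrightarrow> m b = 0})"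

type_synonym ('m, 'e) chart = "'m set \<times> ('m \<Rightarrow> 'e)"

definition chart_inv :: "('m, 'e) chart \<Rightarrow> 'e \<Rightarrow> 'm" where
  "chart_inv c = inv_into (fst c) (snd c)"

definition analytic_atlas :: "('m::topological_space, 'e::euclidean_space) chart set \<Rightarrow> bool" where
  "analytic_atlas A \<longleftrightarrow>
     (\<Union>c\<in>A. fst c) = UNIV \<and>
     (\<forall>c\<in>A. open (fst c) \<and> open (snd c ` fst c) \<and>
        homeomorphism (fst c) (snd c ` fst c) (snd c) (chart_inv c)) \<and>
     (\<forall>c\<in>A. \<forall>d\<in>A. real_analytic_on (snd d \<circ> chart_inv c) (snd c ` (fst c \<inter> fst d)))"

definition flat_atlas :: "('e, 'e) chart set" where
  "flat_atlas = {(UNIV, id)}"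

definition prod_atlas ::
    "('m, 'e) chart set \<Rightarrow> ('n, 'f) chart set \<Rightarrow> ('m \<times> 'n, 'e \<times> 'f) chart set" where
  "prod_atlas A B = {(fst c \<times> fst d, map_prod (snd c) (snd d)) | c d. c \<in> A \<and> d \<in> B}"

text \<open>\<open>f\<close> has, near every point of the open set \<open>S\<close>, a coordinate representation of regularity
  \<open>reg\<close> (\<^const>\<open>smooth_on\<close> or \<^const>\<open>real_analytic_on\<close>).\<close>

definition map_of_class ::
    "(('e \<Rightarrow> 'f) \<Rightarrow> 'e set \<Rightarrow> bool) \<Rightarrow> ('m::topological_space, 'e) chart set \<Rightarrow>
     ('n, 'f) chart set \<Rightarrow> ('m \<Rightarrow> 'n) \<Rightarrow> 'm set \<Rightarrow> bool" where
  "map_of_class reg A B f S \<longleftrightarrow>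
     (\<forall>p\<in>S. \<exists>c\<in>A. \<exists>d\<in>B. \<exists>W. open W \<and> p \<in> W \<and> W \<subseteq> fst c \<inter> S \<and> f ` W \<subseteq> fst d \<and>
        reg (snd d \<circ> f \<circ> chart_inv c) (snd c ` W))"

text \<open>The tangent space at \<open>p\<close> is the model space \<open>'e\<close>, read in a chosen chart around \<open>p\<close>; the
  tangent map \<open>mderiv A B f p\<close> from \<open>T\<^sub>p M\<close> to \<open>T\<^sub>f\<^sub>p N\<close> is then the derivative of the coordinate
  representation of \<open>f\<close> in the charts chosen at \<open>p\<close> and at \<open>f p\<close>. For \<^const>\<open>flat_atlas\<close> the
  tangent spaces are the vector space itself. Covectors at \<open>p\<close> have type \<open>'e \<Rightarrow>\<^sub>L real\<close>.\<close>

definition chart_at :: "('m, 'e) chart set \<Rightarrow> 'm \<Rightarrow> ('m, 'e) chart" where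
  "chart_at A p = (SOME c. c \<in> A \<and> p \<in> fst c)"

definition coord_rep ::
    "('m, 'e) chart set \<Rightarrow> ('n, 'f) chart set \<Rightarrow> ('m \<Rightarrow> 'n) \<Rightarrow> 'm \<Rightarrow> 'e \<Rightarrow> 'f" where
  "coord_rep A B f p = snd (chart_at B (f p)) \<circ> f \<circ> chart_inv (chart_at A p)"

definition mdifferentiable ::
    "('m::t2_space, 'e::real_normed_vector) chart set \<Rightarrow>
     ('n::t2_space, 'f::real_normed_vector) chart set \<Rightarrow> ('m \<Rightarrow> 'n) \<Rightarrow> 'm \<Rightarrow> bool" where
  "mdifferentiable A B f p \<longleftrightarrow>
     isCont f p \<and> coord_rep A B f p differentiable (at (snd (chart_at A p) p))"

definition mderiv ::
    "('m, 'e::real_normed_vector) chart set \<Rightarrow> ('n, 'f::real_normed_vector) chart set \<Rightarrow>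
     ('m \<Rightarrow> 'n) \<Rightarrow> 'm \<Rightarrow> 'e \<Rightarrow> 'f" where
  "mderiv A B f p = frechet_derivative (coord_rep A B f p) (at (snd (chart_at A p) p))"

definition ae_differentiable ::
    "('m::t2_space, 'e::euclidean_space) chart set \<Rightarrow> ('m \<Rightarrow> real) \<Rightarrow> bool" where
  "ae_differentiable A f \<longleftrightarrow>
     (\<forall>c\<in>A. negligible (snd c ` {p \<in> fst c. \<not> mdifferentiable A flat_atlas f p}))"

definition dual_map :: "('a::real_normed_vector \<Rightarrow> 'b::real_normed_vector) \<Rightarrow>
    ('b \<Rightarrow>\<^sub>L real) \<Rightarrow> ('a \<Rightarrow>\<^sub>L real)" where
  "dual_map L \<phi> = Blinfun (\<lambda>x. blinfun_apply \<phi> (L x))"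

text \<open>The topology is carried by the type. The Lie algebra is the tangent space at the identity,
  i.e. the type \<open>'e\<close>.\<close>

definition lie_group ::
    "'g::{t2_space, second_countable_topology} monoid \<Rightarrow> ('g, 'e::euclidean_space) chart set \<Rightarrow> bool"
  where
  "lie_group G A \<longleftrightarrow> group G \<and> carrier G = UNIV \<and> analytic_atlas A \<and>
     map_of_class real_analytic_on (prod_atlas A A) A (\<lambda>(g, h). g \<otimes>\<^bsub>G\<^esub> h) UNIV \<and>
     map_of_class real_analytic_on A A (\<lambda>g. inv\<^bsub>G\<^esub> g) UNIV"

text \<open>The exponential map is the unique map such that every \<open>t \<mapsto> E (t \<xi>)\<close> is a one-parameter subgroup
  with velocity \<open>\<xi>\<close> at \<open>t = 0\<close>. (Differentiability at \<open>0\<close> propagates to all \<open>t\<close>.)\<close>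

definition is_lie_exp ::
    "'g::t2_space monoid \<Rightarrow> ('g, 'e::euclidean_space) chart set \<Rightarrow> ('e \<Rightarrow> 'g) \<Rightarrow> bool" where
  "is_lie_exp G A E \<longleftrightarrow> (\<forall>\<xi>.
     (\<forall>a b. E ((a + b) *\<^sub>R \<xi>) = E (a *\<^sub>R \<xi>) \<otimes>\<^bsub>G\<^esub> E (b *\<^sub>R \<xi>)) \<and>
     mdifferentiable flat_atlas A (\<lambda>t::real. E (t *\<^sub>R \<xi>)) 0 \<and>
     mderiv flat_atlas A (\<lambda>t::real. E (t *\<^sub>R \<xi>)) 0 1 = \<xi>)"

text \<open>\<open>R\<close> is an analytic diffeomorphism from a neighbourhood \<open>U\<close> of \<open>0\<close> onto a neighbourhood of the
  identity; its values outside \<open>U\<close> are irrelevant. As usual for retraction maps in discrete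
  mechanics (exponential, Cayley map), \<open>R (- \<xi>)\<close> is the inverse of \<open>R \<xi>\<close>.\<close>

definition retraction_map ::
    "'g::t2_space monoid \<Rightarrow> ('g, 'e::euclidean_space) chart set \<Rightarrow> 'e set \<Rightarrow> ('e \<Rightarrow> 'g) \<Rightarrow> bool"
  where
  "retraction_map G A U R \<longleftrightarrow>
     open U \<and> 0 \<in> U \<and> R 0 = \<one>\<^bsub>G\<^esub> \<and> inj_on R U \<and> open (R ` U) \<and>
     map_of_class real_analytic_on flat_atlas A R U \<and>
     map_of_class real_analytic_on A flat_atlas (inv_into U R) (R ` U) \<and>
     (\<forall>\<xi>\<in>U. - \<xi> \<in> U \<and> R \<xi> \<otimes>\<^bsub>G\<^esub> R (- \<xi>) = \<one>\<^bsub>G\<^esub>)"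

text \<open>Right-trivialized tangent: \<open>T\<^sub>\<xi> R \<eta> = T (right translation by R \<xi>) (dR\<^sub>\<xi> \<eta>)\<close>.\<close>

definition dretr ::
    "'g monoid \<Rightarrow> ('g, 'e::euclidean_space) chart set \<Rightarrow> ('e \<Rightarrow> 'g) \<Rightarrow> 'e \<Rightarrow> 'e \<Rightarrow> 'e" where
  "dretr G A R \<xi> \<eta> =
     (THE \<zeta>. mderiv flat_atlas A R \<xi> \<eta> = mderiv A A (\<lambda>x. x \<otimes>\<^bsub>G\<^esub> R \<xi>) \<one>\<^bsub>G\<^esub> \<zeta>)"

definition dretr_inv ::
    "'g monoid \<Rightarrow> ('g, 'e::euclidean_space) chart set \<Rightarrow> ('e \<Rightarrow> 'g) \<Rightarrow> 'e \<Rightarrow> 'e \<Rightarrow> 'e" where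
  "dretr_inv G A R \<xi> = inv_into UNIV (dretr G A R \<xi>)"

definition left_representation ::
    "'g::t2_space monoid \<Rightarrow> ('g, 'e::euclidean_space) chart set \<Rightarrow>
     ('g \<Rightarrow> 'v::euclidean_space \<Rightarrow>\<^sub>L 'v) \<Rightarrow> bool" where
  "left_representation G A \<rho> \<longleftrightarrow>
     \<rho> \<one>\<^bsub>G\<^esub> = id_blinfun \<and>
     (\<forall>g h. \<rho> (g \<otimes>\<^bsub>G\<^esub> h) = \<rho> g o\<^sub>L \<rho> h) \<and>
     (\<forall>v. map_of_class smooth_on A flat_atlas (\<lambda>g. \<rho> g v) UNIV)"

text \<open>\<open>\<langle>\<rho>\<^sup>*\<^sub>g(\<alpha>), v\<rangle> = \<langle>\<alpha>, \<rho>\<^sub>g(v)\<rangle>\<close>; this is a right action.\<close>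

definition dual_rep ::
    "('g \<Rightarrow> 'v::euclidean_space \<Rightarrow>\<^sub>L 'v) \<Rightarrow> 'g \<Rightarrow> ('v \<Rightarrow>\<^sub>L real) \<Rightarrow> ('v \<Rightarrow>\<^sub>L real)" where
  "dual_rep \<rho> g \<alpha> = \<alpha> o\<^sub>L \<rho> g"

definition inf_rep ::
    "('g \<Rightarrow> 'v::euclidean_space \<Rightarrow>\<^sub>L 'v) \<Rightarrow> ('e::euclidean_space \<Rightarrow> 'g) \<Rightarrow> 'e \<Rightarrow> 'v \<Rightarrow> 'v" where
  "inf_rep \<rho> E \<xi> v = vector_derivative (\<lambda>t. \<rho> (E (t *\<^sub>R \<xi>)) v) (at 0)"

definition momentum_map ::
    "('g \<Rightarrow> 'v::euclidean_space \<Rightarrow>\<^sub>L 'v) \<Rightarrow> ('e::euclidean_space \<Rightarrow> 'g) \<Rightarrow>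
     'v \<Rightarrow> ('v \<Rightarrow>\<^sub>L real) \<Rightarrow> ('e \<Rightarrow>\<^sub>L real)" where
  "momentum_map \<rho> E v \<alpha> = Blinfun (\<lambda>\<xi>. blinfun_apply \<alpha> (inf_rep \<rho> E \<xi> v))"

text \<open>Agents are the numbers \<open>1, \<dots>, nag\<close>; a configuration is a function \<open>q\<close> from agents to \<open>'g\<close>, and a
  trajectory \<open>g\<close> assigns to each step \<open>k\<close> the configuration \<open>g k\<close> (so \<open>g k i\<close> is \<open>g\<^sub>i\<^sup>k\<close>), and likewise for
  controls and multipliers. Only agents \<open>1, \<dots>, nag\<close> and steps \<open>0, \<dots>, nsteps\<close> matter.\<close>

record (overloaded) ('g, 'e, 'v) control_problem =
  grp :: "'g monoid"
  atl :: "('g, 'e::euclidean_space) chart set"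
  lexp :: "'e \<Rightarrow> 'g"
  rep :: "'g \<Rightarrow> 'v::euclidean_space \<Rightarrow>\<^sub>L 'v"
  nag :: nat
  edges :: "(nat \<times> nat) set"
  cost :: "nat \<Rightarrow> 'g \<Rightarrow> 'e \<Rightarrow> real"
  coll :: "nat \<Rightarrow> nat \<Rightarrow> 'g \<Rightarrow> 'g \<Rightarrow> real"
  obst :: "nat \<Rightarrow> 'g \<Rightarrow> real"
  obst_ext :: "nat \<Rightarrow> 'g \<Rightarrow> ('v \<Rightarrow>\<^sub>L real) \<Rightarrow> real"
  alpha0 :: "nat \<Rightarrow> 'v \<Rightarrow>\<^sub>L real"
  radius :: real
  retr_dom :: "'e set"
  retr :: "'e \<Rightarrow> 'g"
  horizon :: real
  nsteps :: nat
  g_init :: "nat \<Rightarrow> 'g"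
  g_final :: "nat \<Rightarrow> 'g"
  u_init :: "nat \<Rightarrow> 'e"
  u_final :: "nat \<Rightarrow> 'e"

abbreviation agents :: "('g, 'e::euclidean_space, 'v::euclidean_space) control_problem \<Rightarrow> nat set"
  where "agents P \<equiv> {1..nag P}"

abbreviation neighbours ::
    "('g, 'e::euclidean_space, 'v::euclidean_space) control_problem \<Rightarrow> nat \<Rightarrow> nat set" where
  "neighbours P i \<equiv> {j \<in> agents P. (i, j) \<in> edges P}"

abbreviation tstep :: "('g, 'e::euclidean_space, 'v::euclidean_space) control_problem \<Rightarrow> real" where
  "tstep P \<equiv> horizon P / real (nsteps P)"

definition standing_assumptions ::
    "('g::{metric_space, second_countable_topology}, 'e::euclidean_space, 'v::euclidean_space)
      control_problem \<Rightarrow> bool" where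
  "standing_assumptions P \<longleftrightarrow>
     nag P \<ge> 2 \<and>
     edges P \<subseteq> agents P \<times> agents P \<and> sym (edges P) \<and>
     (\<forall>i\<in>agents P. \<forall>j\<in>agents P. (i, j) \<in> (edges P)\<^sup>*) \<and>
     lie_group (grp P) (atl P) \<and>
     is_lie_exp (grp P) (atl P) (lexp P) \<and>
     horizon P > 0 \<and> nsteps P > 0 \<and>
     retraction_map (grp P) (atl P) (retr_dom P) (retr P) \<and>
     radius P > 0 \<and>
     (\<exists>q. \<forall>i\<in>agents P. \<forall>j\<in>agents P. i \<noteq> j \<longrightarrow> dist (q i :: 'g) (q j) > 2 * radius P) \<and>
     left_representation (grp P) (atl P) (rep P) \<and>
     (\<forall>i\<in>agents P.
        ae_differentiable (prod_atlas (atl P) flat_atlas) (\<lambda>(g, u). cost P i g u) \<and>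
        (\<forall>g h u. cost P i (g \<otimes>\<^bsub>grp P\<^esub> h) u = cost P i h u)) \<and>
     (\<forall>i\<in>agents P. \<forall>j\<in>neighbours P i.
        coll P i j = coll P j i \<and>
        ae_differentiable (prod_atlas (atl P) (atl P)) (\<lambda>(x, y). coll P i j x y) \<and>
        (\<forall>g x y. coll P i j (g \<otimes>\<^bsub>grp P\<^esub> x) (g \<otimes>\<^bsub>grp P\<^esub> y) = coll P i j x y)) \<and>
     (\<forall>i\<in>agents P.
        ae_differentiable (atl P) (obst P i) \<and>
        \<not> (\<forall>g h. obst P i (g \<otimes>\<^bsub>grp P\<^esub> h) = obst P i h)) \<and>
     (\<forall>i\<in>agents P. \<forall>g. obst_ext P i g (alpha0 P i) = obst P i g) \<and>
     (\<forall>i\<in>agents P. \<forall>g h \<alpha>.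
        obst_ext P i (g \<otimes>\<^bsub>grp P\<^esub> h) (dual_rep (rep P) (inv\<^bsub>grp P\<^esub> g) \<alpha>) = obst_ext P i h \<alpha>) \<and>
     (\<forall>i\<in>agents P. \<forall>g h. dual_rep (rep P) g (alpha0 P i) = alpha0 P i \<longrightarrow>
        obst P i (g \<otimes>\<^bsub>grp P\<^esub> h) = obst P i h)"

definition coll_total ::
    "('g, 'e::euclidean_space, 'v::euclidean_space) control_problem \<Rightarrow> nat \<Rightarrow> (nat \<Rightarrow> 'g) \<Rightarrow> real" where
  "coll_total P i q = 1/2 * (\<Sum>j\<in>neighbours P i. coll P i j (q i) (q j))"

abbreviation rel_step :: "('g, 'e::euclidean_space, 'v::euclidean_space) control_problem \<Rightarrow>
    (nat \<Rightarrow> 'g) \<Rightarrow> (nat \<Rightarrow> 'g) \<Rightarrow> nat \<Rightarrow> 'g" where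
  "rel_step P q q' \<equiv> (\<lambda>i. inv\<^bsub>grp P\<^esub> (q i) \<otimes>\<^bsub>grp P\<^esub> q' i)"

text \<open>The inverse retraction is the inverse of \<open>R\<close> restricted to \<open>retr_dom\<close>.\<close>

abbreviation retr_inv ::
    "('g, 'e::euclidean_space, 'v::euclidean_space) control_problem \<Rightarrow> 'g \<Rightarrow> 'e" where
  "retr_inv P \<equiv> inv_into (retr_dom P) (retr P)"

definition aug_lagrangian ::
    "('g, 'e::euclidean_space, 'v::euclidean_space) control_problem \<Rightarrow>
     (nat \<Rightarrow> 'g) \<Rightarrow> (nat \<Rightarrow> 'g) \<Rightarrow> (nat \<Rightarrow> 'e) \<Rightarrow> (nat \<Rightarrow> 'e \<Rightarrow>\<^sub>L real) \<Rightarrow> real" where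
  "aug_lagrangian P q q' w m = tstep P * (\<Sum>i\<in>agents P.
     cost P i (q i) (w i) + obst P i (q i) + coll_total P i q +
     m i ((1 / tstep P) *\<^sub>R retr_inv P (rel_step P q q' i) - w i))"

text \<open>The configuration with the first agent set to the identity, the others unchanged: this is how
  an element \<open>(g\<^sub>2, \<dots>, g\<^sub>s)\<close> of \<open>G\<^sup>s\<^sup>-\<^sup>1\<close> is inserted into the collision potentials.\<close>

definition pin_first ::
    "('g, 'e::euclidean_space, 'v::euclidean_space) control_problem \<Rightarrow> (nat \<Rightarrow> 'g) \<Rightarrow> nat \<Rightarrow> 'g" where
  "pin_first P q = q(1 := \<one>\<^bsub>grp P\<^esub>)"

definition reduced_aug_lagrangian ::
    "('g, 'e::euclidean_space, 'v::euclidean_space) control_problem \<Rightarrow>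
     (nat \<Rightarrow> 'g) \<Rightarrow> (nat \<Rightarrow> 'g) \<Rightarrow> (nat \<Rightarrow> 'e) \<Rightarrow> (nat \<Rightarrow> 'e \<Rightarrow>\<^sub>L real) \<Rightarrow> (nat \<Rightarrow> 'v \<Rightarrow>\<^sub>L real) \<Rightarrow> real" where
  "reduced_aug_lagrangian P q \<xi> w m a = tstep P * (\<Sum>i\<in>agents P.
     cost P i \<one>\<^bsub>grp P\<^esub> (w i) + obst_ext P i \<one>\<^bsub>grp P\<^esub> (a i) +
     m i ((1 / tstep P) *\<^sub>R retr_inv P (\<xi> i) - w i) + coll_total P i (pin_first P q))"

definition advected ::
    "('g, 'e::euclidean_space, 'v::euclidean_space) control_problem \<Rightarrow>
     (nat \<Rightarrow> 'g) \<Rightarrow> nat \<Rightarrow> 'v \<Rightarrow>\<^sub>L real" where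
  "advected P q i = dual_rep (rep P) (q i) (alpha0 P i)"

text \<open>The constraint holds within the domain on which the retraction is invertible. The control
  problem only involves \<open>u 0, \<dots>, u (nsteps - 1)\<close>; \<open>u nsteps\<close> just stores the terminal value.\<close>

definition feasible ::
    "('g, 'e::euclidean_space, 'v::euclidean_space) control_problem \<Rightarrow>
     (nat \<Rightarrow> nat \<Rightarrow> 'g) \<Rightarrow> (nat \<Rightarrow> nat \<Rightarrow> 'e) \<Rightarrow> bool" where
  "feasible P g u \<longleftrightarrow>
     (\<forall>i\<in>agents P. g 0 i = g_init P i \<and> g (nsteps P) i = g_final P i \<and>
        u 0 i = u_init P i \<and> u (nsteps P) i = u_final P i \<and>
        (\<forall>k<nsteps P. tstep P *\<^sub>R u k i \<in> retr_dom P \<and>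
           g (Suc k) i = g k i \<otimes>\<^bsub>grp P\<^esub> retr P (tstep P *\<^sub>R u k i)))"

text \<open>A smooth one-parameter variation respecting the boundary data (not the constraint, which is
  taken care of by the multipliers).\<close>

definition variation ::
    "('g::t2_space, 'e::euclidean_space, 'v::euclidean_space) control_problem \<Rightarrow>
     (nat \<Rightarrow> nat \<Rightarrow> 'g) \<Rightarrow> (nat \<Rightarrow> nat \<Rightarrow> 'e) \<Rightarrow>
     (real \<Rightarrow> nat \<Rightarrow> nat \<Rightarrow> 'g) \<Rightarrow> (real \<Rightarrow> nat \<Rightarrow> nat \<Rightarrow> 'e) \<Rightarrow> bool" where
  "variation P g u gv uv \<longleftrightarrow>
     (\<forall>i\<in>agents P. \<forall>k\<le>nsteps P.
        gv 0 k i = g k i \<and> uv 0 k i = u k i \<and>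
        (\<exists>\<delta>>0. map_of_class smooth_on flat_atlas (atl P) (\<lambda>\<epsilon>. gv \<epsilon> k i) {-\<delta><..<\<delta>} \<and>
               smooth_on (\<lambda>\<epsilon>. uv \<epsilon> k i) {-\<delta><..<\<delta>})) \<and>
     (\<forall>i\<in>agents P. \<forall>k\<in>{0, nsteps P}. \<forall>\<epsilon>. gv \<epsilon> k i = g k i \<and> uv \<epsilon> k i = u k i)"

text \<open>Normal extrema: the cost enters the Lagrangian with multiplier \<open>1\<close>.\<close>

definition normal_extremum ::
    "('g::t2_space, 'e::euclidean_space, 'v::euclidean_space) control_problem \<Rightarrow>
     (nat \<Rightarrow> nat \<Rightarrow> 'g) \<Rightarrow> (nat \<Rightarrow> nat \<Rightarrow> 'e) \<Rightarrow> (nat \<Rightarrow> nat \<Rightarrow> 'e \<Rightarrow>\<^sub>L real) \<Rightarrow> bool" where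
  "normal_extremum P g u \<mu> \<longleftrightarrow> feasible P g u \<and>
     (\<forall>gv uv. variation P g u gv uv \<longrightarrow>
        ((\<lambda>\<epsilon>. \<Sum>k<nsteps P. aug_lagrangian P (gv \<epsilon> k) (gv \<epsilon> (Suc k)) (uv \<epsilon> k) (\<mu> k))
           has_real_derivative 0) (at 0))"

text \<open>Extrema of the reduced Lagrangian. The variations of the relative steps and of the advected
  parameters are those induced by the variations of \<open>g\<close>. Since the collision potentials are evaluated
  at the pinned configuration, they do not respond to variations of the first agent; this is where
  the notion differs from \<^const>\<open>normal_extremum\<close>.\<close>

definition reduced_normal_extremum ::
    "('g::t2_space, 'e::euclidean_space, 'v::euclidean_space) control_problem \<Rightarrow>
     (nat \<Rightarrow> nat \<Rightarrow> 'g) \<Rightarrow> (nat \<Rightarrow> nat \<Rightarrow> 'e) \<Rightarrow> (nat \<Rightarrow> nat \<Rightarrow> 'e \<Rightarrow>\<^sub>L real) \<Rightarrow> bool" where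
  "reduced_normal_extremum P g u \<mu> \<longleftrightarrow> feasible P g u \<and>
     (\<forall>gv uv. variation P g u gv uv \<longrightarrow>
        ((\<lambda>\<epsilon>. \<Sum>k<nsteps P. reduced_aug_lagrangian P (gv \<epsilon> k)
                  (rel_step P (gv \<epsilon> k) (gv \<epsilon> (Suc k))) (uv \<epsilon> k) (\<mu> k) (advected P (gv \<epsilon> k)))
           has_real_derivative 0) (at 0))"

text \<open>Partial derivatives. The covector \<open>\<partial>V\<^sub>l/\<partial>g\<^sub>i\<close> at the configuration \<open>q\<close> lives in the cotangent
  space at \<open>q i\<close>; the derivative of a function on the dual space \<open>V\<^sup>*\<close> is an element of \<open>V\<close>.\<close>

definition d_coll ::
    "('g, 'e::euclidean_space, 'v::euclidean_space) control_problem \<Rightarrow>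
     nat \<Rightarrow> nat \<Rightarrow> (nat \<Rightarrow> 'g) \<Rightarrow> ('e \<Rightarrow>\<^sub>L real)" where
  "d_coll P l i q = Blinfun (mderiv (atl P) flat_atlas (\<lambda>x. coll_total P l (q(i := x))) (q i))"

definition d_cost ::
    "('g, 'e::euclidean_space, 'v::euclidean_space) control_problem \<Rightarrow> nat \<Rightarrow> 'e \<Rightarrow> ('e \<Rightarrow>\<^sub>L real)" where
  "d_cost P i w = Blinfun (frechet_derivative (cost P i \<one>\<^bsub>grp P\<^esub>) (at w))"

definition d_obst ::
    "('g, 'e::euclidean_space, 'v::euclidean_space) control_problem \<Rightarrow>
     nat \<Rightarrow> ('v \<Rightarrow>\<^sub>L real) \<Rightarrow> 'v" where
  "d_obst P i a = (THE v. (obst_ext P i \<one>\<^bsub>grp P\<^esub> has_derivative (\<lambda>\<beta>. blinfun_apply \<beta> v)) (at a))"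

text \<open>\<open>T\<^sup>*\<^sub>e L\<^sub>g\<close>: pulls covectors at \<open>g\<close> back to the dual of the Lie algebra.\<close>

definition left_pullback ::
    "('g, 'e::euclidean_space, 'v::euclidean_space) control_problem \<Rightarrow>
     'g \<Rightarrow> ('e \<Rightarrow>\<^sub>L real) \<Rightarrow> ('e \<Rightarrow>\<^sub>L real)" where
  "left_pullback P g = dual_map (mderiv (atl P) (atl P) (\<lambda>x. g \<otimes>\<^bsub>grp P\<^esub> x) \<one>\<^bsub>grp P\<^esub>)"

definition retr_pullback ::
    "('g, 'e::euclidean_space, 'v::euclidean_space) control_problem \<Rightarrow>
     'e \<Rightarrow> ('e \<Rightarrow>\<^sub>L real) \<Rightarrow> ('e \<Rightarrow>\<^sub>L real)" where
  "retr_pullback P \<xi> = dual_map (dretr_inv (grp P) (atl P) (retr P) \<xi>)"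

text \<open>The potentials are only differentiable almost everywhere; this says that the derivatives of the
  cost and of the obstacle potentials occurring at interior steps exist, respectively those of the
  collision potentials with respect to the agents in \<open>I\<close>, at the configurations \<open>c k\<close>.\<close>

definition differentiable_along ::
    "('g::t2_space, 'e::euclidean_space, 'v::euclidean_space) control_problem \<Rightarrow>
     (nat \<Rightarrow> nat \<Rightarrow> 'g) \<Rightarrow> (nat \<Rightarrow> nat \<Rightarrow> 'e) \<Rightarrow> bool" where
  "differentiable_along P g u \<longleftrightarrow> (\<forall>i\<in>agents P. \<forall>k\<in>{1..<nsteps P}.
     cost P i \<one>\<^bsub>grp P\<^esub> differentiable (at (u k i)) \<and>
     obst_ext P i \<one>\<^bsub>grp P\<^esub> differentiable (at (advected P (g k) i)))"

definition coll_differentiable_along ::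
    "('g::t2_space, 'e::euclidean_space, 'v::euclidean_space) control_problem \<Rightarrow>
     nat set \<Rightarrow> (nat \<Rightarrow> nat \<Rightarrow> 'g) \<Rightarrow> bool" where
  "coll_differentiable_along P I c \<longleftrightarrow> (\<forall>l\<in>agents P. \<forall>i\<in>I. \<forall>k\<in>{1..<nsteps P}.
     mdifferentiable (atl P) flat_atlas (\<lambda>x. coll_total P l ((c k)(i := x))) (c k i))"

end

theory Submission
  imports Defs
begin

text \<open>Invariance of the costs and of the extended obstacle potentials rewrites both discrete Lagrangians
  so that agent \<open>i\<close> enters at step \<open>k\<close> only through \<open>u\<^sub>i\<^sup>k\<close>, the advected parameter, the collision terms,
  and the increments \<open>\<xi>\<^sup>k\<^sup>-\<^sup>1\<^sup>,\<^sup>k\<close> and \<open>\<xi>\<^sup>k\<^sup>,\<^sup>k\<^sup>+\<^sup>1\<close>. Varying \<open>g\<^sub>i\<^sup>k\<close> to \<open>g\<^sub>i\<^sup>k \<phi>\<close> with \<open>\<phi>\<close> near the identity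
  turns the increments into \<open>\<xi>\<^sup>k\<^sup>-\<^sup>1\<^sup>,\<^sup>k \<phi>\<close> and \<open>\<phi>\<^sup>-\<^sup>1 \<xi>\<^sup>k\<^sup>,\<^sup>k\<^sup>+\<^sup>1\<close>, whose \<open>R\<^sup>-\<^sup>1\<close>-images have derivatives
  given by \<open>dR\<^sup>-\<^sup>1\<close> at \<open>- h u\<^sup>k\<^sup>-\<^sup>1\<close> and, up to sign, at \<open>h u\<^sup>k\<close>; the advected
  parameter becomes \<open>\<rho>\<^sup>*\<^sub>\<phi> \<alpha>\<close>, whose derivative pairs to the momentum map. Varying \<open>u\<^sub>i\<^sup>k\<close> gives the multiplier.\<close>

section \<open>Derivatives of maps between manifolds\<close>

text \<open>An analytic atlas weakened to what the derivative calculus uses, namely differentiable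
  transition maps. The flat atlas then qualifies without any power series.\<close>

definition diff_atlas :: "('m::t2_space, 'e::real_normed_vector) chart set \<Rightarrow> bool" where
  "diff_atlas A \<longleftrightarrow>
     (\<Union>c\<in>A. fst c) = UNIV \<and>
     (\<forall>c\<in>A. open (fst c) \<and> open (snd c ` fst c) \<and>
        homeomorphism (fst c) (snd c ` fst c) (snd c) (chart_inv c)) \<and>
     (\<forall>c\<in>A. \<forall>d\<in>A. \<forall>p\<in>fst c \<inter> fst d. (snd d \<circ> chart_inv c) differentiable (at (snd c p)))"

lemma smooth_on_differentiable:
  assumes "smooth_on f S" "x \<in> S"
  shows "f differentiable (at x)"
proof -
  have "C_k (Suc 0) f S"
    using assms unfolding smooth_on_def by blast
  then show ?thesis
    using assms(2) by (auto simp: differentiable_def)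
qed

lemma real_analytic_on_differentiable:
  "real_analytic_on f S \<Longrightarrow> x \<in> S \<Longrightarrow> f differentiable (at x)"
  unfolding real_analytic_on_def by (blast intro: smooth_on_differentiable)

lemma analytic_atlas_imp_diff_atlas: "analytic_atlas A \<Longrightarrow> diff_atlas A"
  unfolding analytic_atlas_def diff_atlas_def
  by (auto intro!: real_analytic_on_differentiable)

lemma chart_inv_flat [simp]: "chart_inv (UNIV, id) = id"
  by (auto simp: chart_inv_def fun_eq_iff)

lemma diff_atlas_flat: "diff_atlas flat_atlas"
  by (auto simp: diff_atlas_def flat_atlas_def homeomorphism_def differentiable_def
      intro!: exI has_derivative_id)

lemma chart_at_flat [simp]: "chart_at flat_atlas p = (UNIV, id)"
  by (auto simp: chart_at_def flat_atlas_def intro!: some_equality)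

lemma coord_rep_flat [simp]: "coord_rep flat_atlas flat_atlas f p = f"
  by (simp add: coord_rep_def)

section \<open>Coordinates in a fixed chart\<close>

context
  fixes A :: "('m::t2_space, 'e::real_normed_vector) chart set"
  assumes A: "diff_atlas A"
begin

lemma chart_at_mem: "chart_at A p \<in> A" and mem_chart_at: "p \<in> fst (chart_at A p)"
proof -
  have "\<exists>c. c \<in> A \<and> p \<in> fst c"
    using A unfolding diff_atlas_def by blast
  then have "chart_at A p \<in> A \<and> p \<in> fst (chart_at A p)"
    unfolding chart_at_def by (rule someI_ex)
  then show "chart_at A p \<in> A" "p \<in> fst (chart_at A p)"
    by blast+
qed

context
  fixes c :: "('m, 'e) chart"
  assumes c: "c \<in> A"
begin

lemma open_chart: "open (fst c)" and open_chart_image: "open (snd c ` fst c)"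
  and chart_homeo: "homeomorphism (fst c) (snd c ` fst c) (snd c) (chart_inv c)"
  using A c unfolding diff_atlas_def by blast+

lemma chart_inv_chart: "p \<in> fst c \<Longrightarrow> chart_inv c (snd c p) = p"
  using chart_homeo by (auto simp: homeomorphism_def)

lemma chart_chart_inv: "x \<in> snd c ` fst c \<Longrightarrow> snd c (chart_inv c x) = x"
  using chart_homeo by (auto simp: homeomorphism_def)

lemma chart_inv_mem: "x \<in> snd c ` fst c \<Longrightarrow> chart_inv c x \<in> fst c"
  using chart_homeo by (auto simp: homeomorphism_def)

lemma isCont_chart: "p \<in> fst c \<Longrightarrow> isCont (snd c) p"
  using chart_homeo open_chart by (auto simp: homeomorphism_def continuous_on_eq_continuous_at)

lemma isCont_chart_inv: "p \<in> fst c \<Longrightarrow> isCont (chart_inv c) (snd c p)"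
  using chart_homeo open_chart_image
  by (auto simp: homeomorphism_def continuous_on_eq_continuous_at)

text \<open>Carries a property of points near \<open>p\<close> over to coordinates; used to show
  that two coordinate representations agree near a point.\<close>

lemma eventually_chart_inv:
  assumes "p \<in> fst c" "eventually Q (nhds p)"
  shows "eventually (\<lambda>x. Q (chart_inv c x)) (nhds (snd c p))"
proof -
  have "filterlim (chart_inv c) (nhds (chart_inv c (snd c p))) (nhds (snd c p))"
    using isCont_chart_inv[OF assms(1)] unfolding isCont_def tendsto_at_iff_tendsto_nhds .
  then have "filterlim (chart_inv c) (nhds p) (nhds (snd c p))"
    by (simp only: chart_inv_chart[OF assms(1)])
  then show ?thesis
    using assms(2) by (auto simp: filterlim_iff)
qed

lemma eventually_in_chart: "p \<in> fst c \<Longrightarrow> eventually (\<lambda>q. q \<in> fst c) (nhds p)"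
  using open_chart by (auto simp: eventually_nhds)

lemma eventually_in_chart_image: "p \<in> fst c \<Longrightarrow> eventually (\<lambda>x. x \<in> snd c ` fst c) (nhds (snd c p))"
  using open_chart_image by (meson eventually_nhds image_eqI)

lemma chart_transition_differentiable:
  "d \<in> A \<Longrightarrow> p \<in> fst c \<Longrightarrow> p \<in> fst d \<Longrightarrow> (snd d \<circ> chart_inv c) differentiable (at (snd c p))"
  using A c unfolding diff_atlas_def by blast

end

end

lemma eventually_isCont:
  "isCont f p \<Longrightarrow> eventually Q (nhds (f p)) \<Longrightarrow> eventually (\<lambda>x. Q (f x)) (nhds p)"
  unfolding isCont_def tendsto_at_iff_tendsto_nhds by (auto simp: filterlim_iff)

lemma has_derivative_cong_nhds:
  assumes "(f has_derivative D) (at x)" "eventually (\<lambda>y. f y = g y) (nhds x)"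
  shows "(g has_derivative D) (at x)"
  using assms(1)
  by (rule has_derivative_transform_eventually)
     (use assms(2) in \<open>auto simp: eventually_at_filter dest: eventually_nhds_x_imp_x elim: eventually_mono\<close>)

text \<open>Relational counterpart of \<open>mderiv\<close>, whose \<open>frechet_derivative\<close>
  says nothing unless the derivative exists. Continuity is demanded because the chart at
  \<open>f p\<close> has arbitrary values off its domain, so the coordinate representation alone
  does not control \<open>f\<close>.\<close>

definition has_mderiv :: "('m::t2_space, 'e::real_normed_vector) chart set \<Rightarrow>
     ('n::t2_space, 'f::real_normed_vector) chart set \<Rightarrow> ('m \<Rightarrow> 'n) \<Rightarrow> 'm \<Rightarrow> ('e \<Rightarrow> 'f) \<Rightarrow> bool" where
  "has_mderiv A B f p D \<longleftrightarrow>
     isCont f p \<and> (coord_rep A B f p has_derivative D) (at (snd (chart_at A p) p))"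

lemma has_mderiv_flat:
  "has_mderiv flat_atlas flat_atlas f p D \<longleftrightarrow> (f has_derivative D) (at p)"
  by (auto simp: has_mderiv_def has_derivative_continuous)

lemma has_mderiv_imp_mderiv: "has_mderiv A B f p D \<Longrightarrow> mderiv A B f p = D"
  unfolding has_mderiv_def mderiv_def by (metis frechet_derivative_at)

lemma mdifferentiable_iff: "mdifferentiable A B f p \<longleftrightarrow> (\<exists>D. has_mderiv A B f p D)"
  by (auto simp: mdifferentiable_def has_mderiv_def differentiable_def)

lemma mdifferentiable_has_mderiv: "mdifferentiable A B f p \<Longrightarrow> has_mderiv A B f p (mderiv A B f p)"
  using has_mderiv_imp_mderiv mdifferentiable_iff by metis

lemma has_mderiv_bounded_linear: "has_mderiv A B f p D \<Longrightarrow> bounded_linear D"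
  by (auto simp: has_mderiv_def has_derivative_bounded_linear)

lemma has_mderiv_unique: "has_mderiv A B f p D \<Longrightarrow> has_mderiv A B f p D' \<Longrightarrow> D = D'"
  using has_mderiv_imp_mderiv by metis

lemma has_mderiv_cong:
  assumes "diff_atlas A" and f: "has_mderiv A B f p D" and ev: "eventually (\<lambda>x. f x = g x) (nhds p)"
  shows "has_mderiv A B g p D"
proof -
  let ?c = "chart_at A p"
  have c: "?c \<in> A" "p \<in> fst ?c"
    using assms(1) by (rule chart_at_mem, rule mem_chart_at)
  have fg: "f p = g p"
    using ev by (rule eventually_nhds_x_imp_x)
  have "isCont g p"
    using f isCont_cong[OF ev] by (simp add: has_mderiv_def)
  moreover have "(coord_rep A B g p has_derivative D) (at (snd ?c p))"
    using f[unfolded has_mderiv_def, THEN conjunct2]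
    by (rule has_derivative_cong_nhds)
       (use eventually_chart_inv[OF assms(1) c ev] in eventually_elim, simp add: coord_rep_def fg)
  ultimately show ?thesis
    by (simp add: has_mderiv_def)
qed

lemma has_mderiv_id:
  assumes A: "diff_atlas A"
  shows "has_mderiv A A (\<lambda>x. x) p (\<lambda>v. v)"
proof -
  let ?c = "chart_at A p"
  have c: "?c \<in> A" "p \<in> fst ?c"
    using A by (rule chart_at_mem, rule mem_chart_at)
  have "((\<lambda>v. v) has_derivative (\<lambda>v. v)) (at (snd ?c p))"
    by (rule has_derivative_ident)
  then have "(coord_rep A A (\<lambda>x. x) p has_derivative (\<lambda>v. v)) (at (snd ?c p))"
    by (rule has_derivative_cong_nhds)
       (use eventually_in_chart_image[OF A c] in eventually_elim,
        simp add: coord_rep_def chart_chart_inv[OF A c(1)])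
  then show ?thesis
    by (simp add: has_mderiv_def)
qed

lemma has_mderiv_const: "has_mderiv A flat_atlas (\<lambda>_. c) p (\<lambda>_. 0)"
  by (simp add: has_mderiv_def coord_rep_def comp_def)

text \<open>Both representations use the same chosen chart at \<open>f p\<close>, so it cancels in
  the composite; continuity of \<open>f\<close> keeps nearby values in the domain where the
  cancellation is valid.\<close>

lemma has_mderiv_chain:
  assumes A: "diff_atlas A" and B: "diff_atlas B"
    and f: "has_mderiv A B f p D" and g: "has_mderiv B C g (f p) E"
  shows "has_mderiv A C (\<lambda>x. g (f x)) p (\<lambda>v. E (D v))"
proof -
  let ?c = "chart_at A p" and ?d = "chart_at B (f p)"
  have c: "?c \<in> A" "p \<in> fst ?c" and d: "?d \<in> B" "f p \<in> fst ?d"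
    using A B by (auto intro: chart_at_mem mem_chart_at)
  have contf: "isCont f p"
    using f by (simp add: has_mderiv_def)
  have fp: "coord_rep A B f p (snd ?c p) = snd ?d (f p)"
    using c by (simp add: coord_rep_def chart_inv_chart[OF A])
  have "((coord_rep B C g (f p) \<circ> coord_rep A B f p) has_derivative (E \<circ> D)) (at (snd ?c p))"
    using f g fp by (intro diff_chain_at) (auto simp: has_mderiv_def)
  then have "(coord_rep A C (\<lambda>x. g (f x)) p has_derivative (E \<circ> D)) (at (snd ?c p))"
    by (rule has_derivative_cong_nhds)
       (use eventually_chart_inv[OF A c eventually_isCont[OF contf eventually_in_chart[OF B d]]]
        in eventually_elim, simp add: coord_rep_def chart_inv_chart[OF B d(1)])
  moreover have "isCont (\<lambda>x. g (f x)) p"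
    using f g by (auto simp: has_mderiv_def intro: isCont_o2)
  ultimately show ?thesis
    by (simp add: has_mderiv_def comp_def)
qed

text \<open>Differentiates \<open>g (f x) = x\<close> by the chain rule. It later inverts the
  tangent maps of translations and of the retraction.\<close>

lemma mderiv_left_inverse:
  assumes A: "diff_atlas A" and B: "diff_atlas B"
    and f: "mdifferentiable A B f p" and g: "mdifferentiable B A g (f p)"
    and gf: "eventually (\<lambda>x. x = g (f x)) (nhds p)"
  shows "mderiv B A g (f p) (mderiv A B f p v) = v"
proof -
  have "has_mderiv A A (\<lambda>x. g (f x)) p (\<lambda>v. mderiv B A g (f p) (mderiv A B f p v))"
    by (rule has_mderiv_chain[OF A B mdifferentiable_has_mderiv[OF f] mdifferentiable_has_mderiv[OF g]])
  moreover have "has_mderiv A A (\<lambda>x. g (f x)) p (\<lambda>v. v)"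
    by (rule has_mderiv_cong[OF A has_mderiv_id[OF A] gf])
  ultimately have "(\<lambda>v. mderiv B A g (f p) (mderiv A B f p v)) = (\<lambda>v. v)"
    by (rule has_mderiv_unique)
  then show ?thesis
    by (rule fun_cong)
qed

text \<open>Regularity of a map supplies some pair of charts, whereas \<open>mderiv\<close> reads
  the pair picked by \<open>chart_at\<close>; transition maps on both sides pass from one to the
  other.\<close>

lemma mdifferentiable_chartI:
  assumes A: "diff_atlas A" and B: "diff_atlas B" and c: "c \<in> A" "p \<in> fst c" and d: "d \<in> B"
    and ev: "eventually (\<lambda>x. f x \<in> fst d) (nhds p)"
    and diff: "(snd d \<circ> f \<circ> chart_inv c) differentiable (at (snd c p))"
  shows "mdifferentiable A B f p"
proof -
  let ?c = "chart_at A p" and ?d = "chart_at B (f p)"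
  have c': "?c \<in> A" "p \<in> fst ?c" and d': "?d \<in> B" "f p \<in> fst ?d"
    using A B by (auto intro: chart_at_mem mem_chart_at)
  have fp: "f p \<in> fst d"
    using ev by (rule eventually_nhds_x_imp_x)
  have Fp: "(snd d \<circ> f \<circ> chart_inv c) (snd c p) = snd d (f p)"
    by (simp add: chart_inv_chart[OF A c])
  \<comment> \<open>Near \<open>p\<close>, \<open>f\<close> is its coordinate representation placed
    between \<open>snd c\<close> and \<open>chart_inv d\<close>, and differentiability makes that
    representation continuous.\<close>
  have "isCont (\<lambda>x. (snd d \<circ> f \<circ> chart_inv c) (snd c x)) p"
    by (rule isCont_o2[OF isCont_chart[OF A c] differentiable_imp_continuous_within[OF diff]])
  then have "isCont (\<lambda>x. chart_inv d ((snd d \<circ> f \<circ> chart_inv c) (snd c x))) p"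
    by (rule isCont_o2) (use isCont_chart_inv[OF B d fp] in \<open>simp only: Fp\<close>)
  moreover have "eventually (\<lambda>x. chart_inv d ((snd d \<circ> f \<circ> chart_inv c) (snd c x)) = f x) (nhds p)"
    using ev eventually_in_chart[OF A c]
    by eventually_elim (simp add: chart_inv_chart[OF A c(1)] chart_inv_chart[OF B d])
  ultimately have cont: "isCont f p"
    by (rule iffD1[OF isCont_cong, rotated])
  have "(snd c \<circ> chart_inv ?c) differentiable (at (snd ?c p))"
    by (rule chart_transition_differentiable[OF A c'(1) c(1) c'(2) c(2)])
  moreover have "(snd d \<circ> f \<circ> chart_inv c) differentiable (at ((snd c \<circ> chart_inv ?c) (snd ?c p)))"
    using diff by (simp add: chart_inv_chart[OF A c'])
  ultimately have "((snd d \<circ> f \<circ> chart_inv c) \<circ> (snd c \<circ> chart_inv ?c)) differentiable (at (snd ?c p))"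
    by (rule differentiable_chain_at)
  moreover have "(snd ?d \<circ> chart_inv d) differentiable
      (at (((snd d \<circ> f \<circ> chart_inv c) \<circ> (snd c \<circ> chart_inv ?c)) (snd ?c p)))"
    using chart_transition_differentiable[OF B d d'(1) fp d'(2)]
    by (simp add: chart_inv_chart[OF A c'] chart_inv_chart[OF A c])
  ultimately have "((snd ?d \<circ> chart_inv d) \<circ> ((snd d \<circ> f \<circ> chart_inv c) \<circ> (snd c \<circ> chart_inv ?c)))
      differentiable (at (snd ?c p))"
    by (rule differentiable_chain_at)
  then obtain D where D: "(((snd ?d \<circ> chart_inv d) \<circ> ((snd d \<circ> f \<circ> chart_inv c) \<circ> (snd c \<circ> chart_inv ?c)))
      has_derivative D) (at (snd ?c p))"
    by (auto simp: differentiable_def)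
  have "(coord_rep A B f p has_derivative D) (at (snd ?c p))"
    using D
    by (rule has_derivative_cong_nhds)
       (use eventually_chart_inv[OF A c' eventually_in_chart[OF A c]] eventually_chart_inv[OF A c' ev]
        in eventually_elim, simp add: coord_rep_def chart_inv_chart[OF B d] chart_inv_chart[OF A c(1)])
  with cont show ?thesis
    by (auto simp: mdifferentiable_def differentiable_def)
qed

text \<open>\<open>reg\<close> stays abstract so that smooth and analytic maps are covered at
  once.\<close>

lemma map_of_class_mdifferentiable:
  assumes A: "diff_atlas A" and B: "diff_atlas B" and f: "map_of_class reg A B f S" and p: "p \<in> S"
    and reg: "\<And>F T x. reg F T \<Longrightarrow> x \<in> T \<Longrightarrow> F differentiable (at x)"
  shows "mdifferentiable A B f p"
proof -
  obtain c d W where W: "c \<in> A" "d \<in> B" "open W" "p \<in> W" "W \<subseteq> fst c \<inter> S" "f ` W \<subseteq> fst d"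
    and F: "reg (snd d \<circ> f \<circ> chart_inv c) (snd c ` W)"
    using f p unfolding map_of_class_def by blast
  show ?thesis
  proof (rule mdifferentiable_chartI[OF A B W(1) _ W(2)])
    show "eventually (\<lambda>x. f x \<in> fst d) (nhds p)"
      using W by (auto simp: eventually_nhds)
    show "(snd d \<circ> f \<circ> chart_inv c) differentiable (at (snd c p))"
      using F W by (intro reg) auto
  qed (use W in auto)
qed

text \<open>The tangent map of a curve with velocity \<open>v\<close> is
  \<open>\<lambda>s. s *\<^sub>R v\<close>, so linearity of \<open>D\<close> turns the chain rule
  into an ordinary vector derivative.\<close>

lemma has_mderiv_curve:
  fixes \<phi> :: "real \<Rightarrow> 'm::t2_space" and F :: "'m \<Rightarrow> 'f::real_normed_vector"
  assumes A: "diff_atlas A" and \<phi>: "has_mderiv flat_atlas A \<phi> t (\<lambda>s. s *\<^sub>R v)"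
    and F: "has_mderiv A flat_atlas F (\<phi> t) D"
  shows "((\<lambda>s. F (\<phi> s)) has_vector_derivative D v) (at t)"
proof -
  have "((\<lambda>s. F (\<phi> s)) has_derivative (\<lambda>s. D (s *\<^sub>R v))) (at t)"
    using has_mderiv_chain[OF diff_atlas_flat A \<phi> F] by (simp add: has_mderiv_flat)
  moreover have "D (s *\<^sub>R v) = s *\<^sub>R D v" for s
    using has_mderiv_bounded_linear[OF F] by (simp add: linear_simps)
  ultimately show ?thesis
    by (simp add: has_vector_derivative_def)
qed

lemma has_mderiv_compose_flat:
  assumes "diff_atlas A" "has_mderiv A flat_atlas f p D" "(g has_derivative E) (at (f p))"
  shows "has_mderiv A flat_atlas (\<lambda>x. g (f x)) p (\<lambda>v. E (D v))"
  by (rule has_mderiv_chain[OF assms(1) diff_atlas_flat assms(2)]) (simp add: has_mderiv_flat assms(3))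

section \<open>Smooth curves\<close>

lemma C_k_const: "C_k k (\<lambda>x. c) S"
proof (induction k arbitrary: c)
  case (Suc k)
  then show ?case
    by (auto intro!: exI[of _ "\<lambda>x v. 0"])
qed simp

lemma C_k_affine: "C_k k (\<lambda>t::real. a + t *\<^sub>R v) S"
proof (cases k)
  case (Suc m)
  then show ?thesis
    by (auto intro!: exI[of _ "\<lambda>x s. s *\<^sub>R v"] C_k_const derivative_eq_intros)
qed (auto intro!: continuous_intros)

text \<open>On an open set \<open>g\<close> has the very derivative \<open>D\<close> of
  \<open>f\<close>, so the condition on the directional components carries over unchanged and a case
  split replaces induction.\<close>

lemma C_k_cong:
  assumes "open S" "\<And>x. x \<in> S \<Longrightarrow> f x = g x" "C_k k f S"
  shows "C_k k g S"
proof (cases k)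
  case 0
  then show ?thesis
    using assms by (simp cong: continuous_on_cong)
next
  case (Suc m)
  then obtain D where "\<forall>x\<in>S. (f has_derivative D x) (at x)" "\<forall>v. C_k m (\<lambda>x. D x v) S"
    using assms(3) by auto
  moreover have "\<forall>x\<in>S. (g has_derivative D x) (at x)"
    using calculation(1) assms(1,2) has_derivative_transform_within_open by blast
  ultimately show ?thesis
    using Suc by auto
qed

lemma smooth_on_affine: "open S \<Longrightarrow> smooth_on (\<lambda>t::real. a + t *\<^sub>R v) S"
  by (simp add: smooth_on_def C_k_affine)

lemma smooth_on_const: "open S \<Longrightarrow> smooth_on (\<lambda>t. a) S"
  by (simp add: smooth_on_def C_k_const)

lemma smooth_on_cong:
  "smooth_on f S \<Longrightarrow> (\<And>x. x \<in> S \<Longrightarrow> f x = g x) \<Longrightarrow> smooth_on g S"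
  unfolding smooth_on_def using C_k_cong by metis

text \<open>For the agents and steps that a variation leaves in place.\<close>

lemma map_of_class_const:
  fixes p :: "'m::t2_space" and A :: "('m, 'e::real_normed_vector) chart set" and S :: "real set"
  assumes "diff_atlas A" "open S"
  shows "map_of_class smooth_on flat_atlas A (\<lambda>_. p) S"
  unfolding map_of_class_def
proof
  fix t assume "t \<in> S"
  then show "\<exists>c\<in>flat_atlas. \<exists>d\<in>A. \<exists>W. open W \<and> t \<in> W \<and> W \<subseteq> fst c \<inter> S \<and> (\<lambda>_. p) ` W \<subseteq> fst d \<and>
      smooth_on (snd d \<circ> (\<lambda>_. p) \<circ> chart_inv c) (snd c ` W)"
    using assms(2) mem_chart_at[OF assms(1)]
    by (intro bexI[of _ "(UNIV, id)"] bexI[OF _ chart_at_mem[OF assms(1), of p]] exI[of _ S])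
       (auto simp: flat_atlas_def comp_def intro!: smooth_on_const)
qed

text \<open>A straight line with direction \<open>v\<close> in the chart at \<open>p\<close>. It
  realizes every tangent vector as the velocity of an admissible curve, so that stationarity can be
  tested in all directions.\<close>

lemma exists_smooth_curve:
  fixes p :: "'m::t2_space" and A :: "('m, 'e::real_normed_vector) chart set"
  assumes A: "diff_atlas A"
  obtains \<gamma> \<delta> where "\<gamma> 0 = p" "\<delta> > 0" "map_of_class smooth_on flat_atlas A \<gamma> {-\<delta><..<\<delta>}"
    "has_mderiv flat_atlas A \<gamma> 0 (\<lambda>s. s *\<^sub>R v)"
proof -
  let ?c = "chart_at A p"
  define \<beta> where "\<beta> = (\<lambda>t::real. snd ?c p + t *\<^sub>R v)"
  define \<gamma> where "\<gamma> = (\<lambda>t. chart_inv ?c (\<beta> t))"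
  have c: "?c \<in> A" "p \<in> fst ?c"
    using A by (rule chart_at_mem, rule mem_chart_at)
  have \<gamma>0: "\<gamma> 0 = p"
    by (simp add: \<gamma>_def \<beta>_def chart_inv_chart[OF A c])
  have cont: "isCont \<beta> 0"
    unfolding \<beta>_def by (intro continuous_intros)
  have "eventually (\<lambda>t. \<beta> t \<in> snd ?c ` fst ?c) (nhds 0)"
    by (rule eventually_isCont[OF cont])
       (use eventually_in_chart_image[OF A c] in \<open>simp add: \<beta>_def\<close>)
  \<comment> \<open>Past \<open>\<delta>\<close> the line may leave the chart image, where
    \<open>chart_inv\<close> is arbitrary.\<close>
  then obtain \<delta> where \<delta>: "\<delta> > 0" "\<And>t. \<bar>t\<bar> < \<delta> \<Longrightarrow> \<beta> t \<in> snd ?c ` fst ?c"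
    by (auto simp: eventually_nhds_metric dist_real_def)
  have W: "\<beta> t \<in> snd ?c ` fst ?c" if "t \<in> {-\<delta><..<\<delta>}" for t
    using that by (intro \<delta>(2)) auto
  have chart_\<gamma>: "snd ?c (\<gamma> t) = \<beta> t" if "t \<in> {-\<delta><..<\<delta>}" for t
    unfolding \<gamma>_def by (rule chart_chart_inv[OF A c(1) W[OF that]])
  have smooth: "smooth_on (\<lambda>t. snd ?c (\<gamma> t)) {-\<delta><..<\<delta>}"
    by (rule smooth_on_cong[of \<beta>])
       (simp_all add: \<beta>_def[abs_def] smooth_on_affine chart_\<gamma>[symmetric, unfolded \<beta>_def])
  have "map_of_class smooth_on flat_atlas A \<gamma> {-\<delta><..<\<delta>}"
    unfolding map_of_class_def
  proof
    fix t assume t: "t \<in> {-\<delta><..<\<delta>}"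
    show "\<exists>c\<in>flat_atlas. \<exists>d\<in>A. \<exists>W. open W \<and> t \<in> W \<and> W \<subseteq> fst c \<inter> {-\<delta><..<\<delta>} \<and> \<gamma> ` W \<subseteq> fst d \<and>
        smooth_on (snd d \<circ> \<gamma> \<circ> chart_inv c) (snd c ` W)"
      using t smooth
      by (intro bexI[of _ "(UNIV, id)"] bexI[OF _ c(1)] exI[of _ "{-\<delta><..<\<delta>}"])
         (auto simp: flat_atlas_def comp_def \<gamma>_def chart_inv_mem[OF A c(1) W])
  qed
  moreover have "has_mderiv flat_atlas A \<gamma> 0 (\<lambda>s. s *\<^sub>R v)"
  proof -
    have "(\<beta> has_derivative (\<lambda>s. s *\<^sub>R v)) (at 0)"
      unfolding \<beta>_def by (auto intro!: derivative_eq_intros)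
    then have "(coord_rep flat_atlas A \<gamma> 0 has_derivative (\<lambda>s. s *\<^sub>R v)) (at 0)"
    proof (rule has_derivative_cong_nhds)
      show "eventually (\<lambda>t. \<beta> t = coord_rep flat_atlas A \<gamma> 0 t) (nhds 0)"
        unfolding eventually_nhds_metric
        using \<delta>(1)
        by (intro exI[of _ \<delta>]) (auto simp: dist_real_def coord_rep_def \<gamma>0 intro!: chart_\<gamma>[symmetric])
    qed
    moreover have "isCont \<gamma> 0"
      unfolding \<gamma>_def
      by (rule isCont_o2[OF cont]) (use isCont_chart_inv[OF A c] in \<open>simp add: \<beta>_def\<close>)
    ultimately show ?thesis
      by (simp add: has_mderiv_def)
  qed
  ultimately show thesis
    using that \<gamma>0 \<delta>(1) by blast
qed

section \<open>Lie groups with a retraction map\<close>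

locale retracted_lie_group =
  fixes G :: "'g::{t2_space, second_countable_topology} monoid" (structure)
    and A :: "('g, 'e::euclidean_space) chart set" and U :: "'e set" and R :: "'e \<Rightarrow> 'g"
  assumes lie: "lie_group G A" and retr: "retraction_map G A U R"
begin

sublocale group G
  using lie by (simp add: lie_group_def)

lemma carrier_UNIV [simp]: "carrier G = UNIV"
  using lie by (simp add: lie_group_def)

lemma atlas: "diff_atlas A"
  using lie by (simp add: lie_group_def analytic_atlas_imp_diff_atlas)

text \<open>Joint analyticity of the product, unpacked into one chart per factor, so that freezing
  one coordinate yields a translation.\<close>

lemma mult_charts:
  obtains c\<^sub>1 c\<^sub>2 d W where "c\<^sub>1 \<in> A" "c\<^sub>2 \<in> A" "d \<in> A" "open W" "(a, b) \<in> W"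
    "W \<subseteq> fst c\<^sub>1 \<times> fst c\<^sub>2" "(\<lambda>(x, y). x \<otimes> y) ` W \<subseteq> fst d"
    "(\<lambda>z. snd d (chart_inv c\<^sub>1 (fst z) \<otimes> chart_inv c\<^sub>2 (snd z))) differentiable (at (snd c\<^sub>1 a, snd c\<^sub>2 b))"
proof -
  have "map_of_class real_analytic_on (prod_atlas A A) A (\<lambda>(x, y). x \<otimes> y) UNIV"
    using lie by (simp add: lie_group_def)
  then obtain c d W where c: "c \<in> prod_atlas A A" and d: "d \<in> A"
    and W: "open W" "(a, b) \<in> W" "W \<subseteq> fst c" "(\<lambda>(x, y). x \<otimes> y) ` W \<subseteq> fst d"
    and F: "real_analytic_on (snd d \<circ> (\<lambda>(x, y). x \<otimes> y) \<circ> chart_inv c) (snd c ` W)"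
    unfolding map_of_class_def by (metis UNIV_I inf_top.right_neutral)
  obtain c\<^sub>1 c\<^sub>2 where c12: "c\<^sub>1 \<in> A" "c\<^sub>2 \<in> A" "c = (fst c\<^sub>1 \<times> fst c\<^sub>2, map_prod (snd c\<^sub>1) (snd c\<^sub>2))"
    using c by (auto simp: prod_atlas_def)
  have ab: "a \<in> fst c\<^sub>1" "b \<in> fst c\<^sub>2"
    using W c12(3) by auto
  have inj: "inj_on (snd c) (fst c)"
    using chart_inv_chart[OF atlas c12(1)] chart_inv_chart[OF atlas c12(2)]
    by (intro inj_on_inverseI[of _ "\<lambda>z. (chart_inv c\<^sub>1 (fst z), chart_inv c\<^sub>2 (snd z))"])
       (auto simp: c12(3))
  \<comment> \<open>\<open>chart_inv c\<close> is an \<open>inv_into\<close> on the product chart.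
    It splits into the inverses of the factors on the product of the chart images, which is open, so
    the derivative transfers.\<close>
  have chart_inv_prod: "chart_inv c z = (chart_inv c\<^sub>1 (fst z), chart_inv c\<^sub>2 (snd z))"
    if z: "fst z \<in> snd c\<^sub>1 ` fst c\<^sub>1" "snd z \<in> snd c\<^sub>2 ` fst c\<^sub>2" for z
    unfolding chart_inv_def[of c]
    using z chart_inv_mem[OF atlas c12(1)] chart_inv_mem[OF atlas c12(2)]
      chart_chart_inv[OF atlas c12(1)] chart_chart_inv[OF atlas c12(2)]
    by (intro inv_into_f_eq[OF inj]) (auto simp: c12(3))
  have "snd c (a, b) \<in> snd c ` W"
    using W(2) by (rule imageI)
  moreover have "snd c (a, b) = (snd c\<^sub>1 a, snd c\<^sub>2 b)"
    by (simp add: c12(3))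
  ultimately obtain D where D: "((snd d \<circ> (\<lambda>(x, y). x \<otimes> y) \<circ> chart_inv c) has_derivative D)
      (at (snd c\<^sub>1 a, snd c\<^sub>2 b))"
    using real_analytic_on_differentiable[OF F] by (metis differentiable_def)
  have "open ((snd c\<^sub>1 ` fst c\<^sub>1) \<times> (snd c\<^sub>2 ` fst c\<^sub>2))"
    by (intro open_Times open_chart_image[OF atlas] c12)
  then have "((\<lambda>z. snd d (chart_inv c\<^sub>1 (fst z) \<otimes> chart_inv c\<^sub>2 (snd z))) has_derivative D)
      (at (snd c\<^sub>1 a, snd c\<^sub>2 b))"
    by (rule has_derivative_transform_within_open[OF D]) (use ab in \<open>auto simp: chart_inv_prod\<close>)
  then show thesis
    using that[OF c12(1,2) d W(1,2)] W(3,4) c12(3) by (auto simp: differentiable_def)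
qed

text \<open>Composes the product in coordinates with the affine slice that freezes the first
  coordinate at that of \<open>a\<close>.\<close>

lemma left_translation_mdifferentiable: "mdifferentiable A A (\<lambda>x. a \<otimes> x) b"
proof -
  obtain c\<^sub>1 c\<^sub>2 d W where c: "c\<^sub>1 \<in> A" "c\<^sub>2 \<in> A" "d \<in> A"
    and W: "open W" "(a, b) \<in> W" "W \<subseteq> fst c\<^sub>1 \<times> fst c\<^sub>2" "(\<lambda>(x, y). x \<otimes> y) ` W \<subseteq> fst d"
    and F: "(\<lambda>z. snd d (chart_inv c\<^sub>1 (fst z) \<otimes> chart_inv c\<^sub>2 (snd z))) differentiable
      (at (snd c\<^sub>1 a, snd c\<^sub>2 b))"
    by (rule mult_charts[of a b])
  show ?thesis
  proof (rule mdifferentiable_chartI[OF atlas atlas c(2) _ c(3)])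
    show "b \<in> fst c\<^sub>2"
      using W by auto
    have "open (Pair a -` W)"
      using W(1) by (intro open_vimage) (auto intro!: continuous_intros)
    then show "eventually (\<lambda>x. a \<otimes> x \<in> fst d) (nhds b)"
      unfolding eventually_nhds using W(2,4) by (intro exI[of _ "Pair a -` W"]) auto
    have "(\<lambda>y. (snd c\<^sub>1 a, y)) differentiable (at (snd c\<^sub>2 b))"
      by (auto simp: differentiable_def intro!: exI derivative_intros)
    then have "((\<lambda>z. snd d (chart_inv c\<^sub>1 (fst z) \<otimes> chart_inv c\<^sub>2 (snd z))) \<circ> (\<lambda>y. (snd c\<^sub>1 a, y)))
        differentiable (at (snd c\<^sub>2 b))"
      using F by (intro differentiable_chain_at) auto
    moreover have "chart_inv c\<^sub>1 (snd c\<^sub>1 a) = a"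
      using W chart_inv_chart[OF atlas c(1)] by auto
    ultimately show "(snd d \<circ> (\<lambda>x. a \<otimes> x) \<circ> chart_inv c\<^sub>2) differentiable (at (snd c\<^sub>2 b))"
      by (simp add: comp_def)
  qed
qed

lemma right_translation_mdifferentiable: "mdifferentiable A A (\<lambda>x. x \<otimes> b) a"
proof -
  obtain c\<^sub>1 c\<^sub>2 d W where c: "c\<^sub>1 \<in> A" "c\<^sub>2 \<in> A" "d \<in> A"
    and W: "open W" "(a, b) \<in> W" "W \<subseteq> fst c\<^sub>1 \<times> fst c\<^sub>2" "(\<lambda>(x, y). x \<otimes> y) ` W \<subseteq> fst d"
    and F: "(\<lambda>z. snd d (chart_inv c\<^sub>1 (fst z) \<otimes> chart_inv c\<^sub>2 (snd z))) differentiable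
      (at (snd c\<^sub>1 a, snd c\<^sub>2 b))"
    by (rule mult_charts[of a b])
  show ?thesis
  proof (rule mdifferentiable_chartI[OF atlas atlas c(1) _ c(3)])
    show "a \<in> fst c\<^sub>1"
      using W by auto
    have "open ((\<lambda>x. (x, b)) -` W)"
      using W(1) by (intro open_vimage) (auto intro!: continuous_intros)
    then show "eventually (\<lambda>x. x \<otimes> b \<in> fst d) (nhds a)"
      unfolding eventually_nhds using W(2,4) by (intro exI[of _ "(\<lambda>x. (x, b)) -` W"]) auto
    have "(\<lambda>y. (y, snd c\<^sub>2 b)) differentiable (at (snd c\<^sub>1 a))"
      by (auto simp: differentiable_def intro!: exI derivative_intros)
    then have "((\<lambda>z. snd d (chart_inv c\<^sub>1 (fst z) \<otimes> chart_inv c\<^sub>2 (snd z))) \<circ> (\<lambda>y. (y, snd c\<^sub>2 b)))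
        differentiable (at (snd c\<^sub>1 a))"
      using F by (intro differentiable_chain_at) auto
    moreover have "chart_inv c\<^sub>2 (snd c\<^sub>2 b) = b"
      using W chart_inv_chart[OF atlas c(2)] by auto
    ultimately show "(snd d \<circ> (\<lambda>x. x \<otimes> b) \<circ> chart_inv c\<^sub>1) differentiable (at (snd c\<^sub>1 a))"
      by (simp add: comp_def)
  qed
qed

section \<open>The retraction, its inverse and the trivialized tangent\<close>

abbreviation Q :: "'g \<Rightarrow> 'e" where "Q \<equiv> inv_into U R"

lemma open_retr_image: "open (R ` U)"
  using retr by (simp add: retraction_map_def)

lemma Q_R: "\<xi> \<in> U \<Longrightarrow> Q (R \<xi>) = \<xi>"
  using retr by (simp add: retraction_map_def)

lemma R_Q: "x \<in> R ` U \<Longrightarrow> R (Q x) = x" and Q_mem: "x \<in> R ` U \<Longrightarrow> Q x \<in> U"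
  by (simp_all add: f_inv_into_f inv_into_into)

lemma zero_mem: "0 \<in> U" and R_0: "R 0 = \<one>" and minus_mem: "\<xi> \<in> U \<Longrightarrow> - \<xi> \<in> U"
  and open_dom: "open U"
  using retr by (auto simp: retraction_map_def)

lemma R_minus: "\<xi> \<in> U \<Longrightarrow> R (- \<xi>) = inv (R \<xi>)"
  using retr inv_unique' by (fastforce simp: retraction_map_def intro: inv_equality[symmetric] inv_comm)

lemma retr_mdifferentiable: "\<xi> \<in> U \<Longrightarrow> mdifferentiable flat_atlas A R \<xi>"
  using retr unfolding retraction_map_def
  by (intro map_of_class_mdifferentiable[OF diff_atlas_flat atlas _ _ real_analytic_on_differentiable]) auto

lemma retr_inv_mdifferentiable: "x \<in> R ` U \<Longrightarrow> mdifferentiable A flat_atlas Q x"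
  using retr unfolding retraction_map_def
  by (intro map_of_class_mdifferentiable[OF atlas diff_atlas_flat _ _ real_analytic_on_differentiable]) auto

text \<open>\<open>U\<close> and its image are open, so \<open>R\<close> and \<open>Q\<close> undo
  each other near every point and their tangent maps are mutually inverse; the other order follows
  below.\<close>

lemma mderiv_retr_retr_inv:
  assumes "\<xi> \<in> U"
  shows "mderiv flat_atlas A R \<xi> (mderiv A flat_atlas Q (R \<xi>) v) = v"
proof -
  have "mdifferentiable flat_atlas A R (Q (R \<xi>))"
    using retr_mdifferentiable[OF assms] by (simp add: Q_R assms)
  moreover have "mdifferentiable A flat_atlas Q (R \<xi>)"
    using assms by (simp add: retr_inv_mdifferentiable)
  moreover have "eventually (\<lambda>x. x = R (Q x)) (nhds (R \<xi>))"
    unfolding eventually_nhds using open_retr_image assms by (intro exI[of _ "R ` U"]) (simp add: R_Q)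
  ultimately have "mderiv flat_atlas A R (Q (R \<xi>)) (mderiv A flat_atlas Q (R \<xi>) v) = v"
    by (intro mderiv_left_inverse[where f = Q] atlas diff_atlas_flat)
  then show ?thesis
    by (simp add: Q_R assms)
qed

lemma mderiv_retr_inv_retr:
  assumes "\<xi> \<in> U"
  shows "mderiv A flat_atlas Q (R \<xi>) (mderiv flat_atlas A R \<xi> v) = v"
proof -
  have "eventually (\<lambda>x. x = Q (R x)) (nhds \<xi>)"
    unfolding eventually_nhds using open_dom assms by (intro exI[of _ U]) (simp add: Q_R)
  then show ?thesis
    using assms
    by (intro mderiv_left_inverse[where f = R] atlas diff_atlas_flat retr_mdifferentiable
        retr_inv_mdifferentiable imageI)
qed

text \<open>Near the identity \<open>inv x = R (- R\<^sup>-\<^sup>1 x)\<close>, which avoids differentiating the multiplication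
  jointly in both factors.\<close>

lemma inverse_has_mderiv_one: "has_mderiv A A (\<lambda>x. inv x) \<one> uminus"
proof -
  have one: "\<one> \<in> R ` U"
    using zero_mem R_0 by force
  have Q1: "Q \<one> = 0"
    using Q_R[OF zero_mem] R_0 by simp
  have "has_mderiv A flat_atlas (\<lambda>x. - Q x) \<one> (\<lambda>v. - mderiv A flat_atlas Q \<one> v)"
    by (rule has_mderiv_compose_flat[OF atlas mdifferentiable_has_mderiv[OF retr_inv_mdifferentiable[OF one]]]) (auto intro!: derivative_intros)
  then have "has_mderiv A A (\<lambda>x. R (- Q x)) \<one>
      (\<lambda>v. mderiv flat_atlas A R 0 (- mderiv A flat_atlas Q \<one> v))"
    by (rule has_mderiv_chain[OF atlas diff_atlas_flat])
       (simp add: Q1 mdifferentiable_has_mderiv retr_mdifferentiable zero_mem)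
  moreover have "(\<lambda>v. mderiv flat_atlas A R 0 (- mderiv A flat_atlas Q \<one> v)) = uminus"
    using mderiv_retr_retr_inv[OF zero_mem] R_0
      has_mderiv_bounded_linear[OF mdifferentiable_has_mderiv[OF retr_mdifferentiable[OF zero_mem]]]
    by (simp add: linear_simps fun_eq_iff)
  ultimately have "has_mderiv A A (\<lambda>x. R (- Q x)) \<one> uminus"
    by simp
  then show ?thesis
    by (rule has_mderiv_cong[OF atlas])
       (use open_retr_image one in
         \<open>auto simp: eventually_nhds R_minus Q_mem R_Q Q_R intro!: exI[of _ "R ` U"]\<close>)
qed

text \<open>Recovers the Lie algebra element from the velocity of a curve through \<open>a\<close>;
  this left-trivializes variations.\<close>

lemma mderiv_left_translation_inverse:
  "mderiv A A (\<lambda>x. inv a \<otimes> x) a (mderiv A A (\<lambda>x. a \<otimes> x) \<one> v) = v"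
  using mderiv_left_inverse[OF atlas atlas left_translation_mdifferentiable[of a \<one>]
      left_translation_mdifferentiable[of "inv a" "a \<otimes> \<one>"]]
  by (simp add: m_assoc[symmetric])

lemma mderiv_right_translation_inverse:
  "mderiv A A (\<lambda>x. x \<otimes> inv a) a (mderiv A A (\<lambda>x. x \<otimes> a) \<one> v) = v"
  using mderiv_left_inverse[OF atlas atlas right_translation_mdifferentiable[of a \<one>]
      right_translation_mdifferentiable[of "inv a" "\<one> \<otimes> a"]]
  by (simp add: m_assoc)

lemma mderiv_right_translation_inverse':
  "mderiv A A (\<lambda>x. x \<otimes> a) \<one> (mderiv A A (\<lambda>x. x \<otimes> inv a) a v) = v"
  using mderiv_left_inverse[OF atlas atlas right_translation_mdifferentiable[of "inv a" a]
      right_translation_mdifferentiable[of a "a \<otimes> inv a"]]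
  by (simp add: m_assoc)

text \<open>Tangent maps of right translations are invertible, so the description in
  \<open>dretr\<close> has a unique solution and \<open>dretr\<close> is a bijection. Its inverse
  translates to \<open>R \<xi>\<close> and then applies the tangent of \<open>Q\<close>.\<close>

lemma dretr_inv_eq:
  assumes \<xi>: "\<xi> \<in> U"
  shows "dretr_inv G A R \<xi> = (\<lambda>\<zeta>. mderiv A flat_atlas Q (R \<xi>) (mderiv A A (\<lambda>x. x \<otimes> R \<xi>) \<one> \<zeta>))"
proof
  fix \<zeta>
  have dretr: "dretr G A R \<xi> = (\<lambda>\<eta>. mderiv A A (\<lambda>x. x \<otimes> inv (R \<xi>)) (R \<xi>) (mderiv flat_atlas A R \<xi> \<eta>))"
    unfolding dretr_def
    by (intro ext the_equality)
       (auto simp: mderiv_right_translation_inverse mderiv_right_translation_inverse')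
  have "inj (dretr G A R \<xi>)"
    by (rule inj_on_inverseI[of _ "\<lambda>\<zeta>. mderiv A flat_atlas Q (R \<xi>) (mderiv A A (\<lambda>x. x \<otimes> R \<xi>) \<one> \<zeta>)"])
       (simp add: dretr mderiv_right_translation_inverse' mderiv_retr_inv_retr \<xi>)
  then show "dretr_inv G A R \<xi> \<zeta> = mderiv A flat_atlas Q (R \<xi>) (mderiv A A (\<lambda>x. x \<otimes> R \<xi>) \<one> \<zeta>)"
    unfolding dretr_inv_def
    by (rule inv_into_f_eq) (simp_all add: dretr mderiv_retr_retr_inv \<xi> mderiv_right_translation_inverse)
qed

text \<open>The working description of the inverse trivialized tangent: the first-order response of
  \<open>Q\<close> at \<open>R \<xi>\<close> to a left factor near the identity.\<close>

lemma dretr_inv_has_mderiv: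
  assumes \<xi>: "\<xi> \<in> U"
  shows "has_mderiv A flat_atlas (\<lambda>x. Q (x \<otimes> R \<xi>)) \<one> (dretr_inv G A R \<xi>)"
  unfolding dretr_inv_eq[OF \<xi>]
  by (rule has_mderiv_chain[OF atlas atlas mdifferentiable_has_mderiv[OF right_translation_mdifferentiable]])
     (simp add: \<xi> mdifferentiable_has_mderiv retr_inv_mdifferentiable)

text \<open>Matches the increment leaving a varied point, where the perturbation enters inverted and
  on the left.\<close>

lemma retr_inv_inverse_mult_has_mderiv:
  assumes \<xi>: "\<xi> \<in> U"
  shows "has_mderiv A flat_atlas (\<lambda>x. Q (inv x \<otimes> R \<xi>)) \<one> (\<lambda>\<eta>. dretr_inv G A R \<xi> (- \<eta>))"
  by (rule has_mderiv_chain[OF atlas atlas inverse_has_mderiv_one]) (simp add: dretr_inv_has_mderiv \<xi>)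

text \<open>Right translation by \<open>x\<close> becomes left translation by \<open>inv x\<close> under \<open>R\<^sup>-\<^sup>1 (inv y) = - R\<^sup>-\<^sup>1 y\<close>.\<close>

lemma retr_inv_mult_has_mderiv:
  assumes \<xi>: "\<xi> \<in> U"
  shows "has_mderiv A flat_atlas (\<lambda>x. Q (R \<xi> \<otimes> x)) \<one> (dretr_inv G A R (- \<xi>))"
proof -
  have "has_mderiv A flat_atlas (\<lambda>x. - Q (inv x \<otimes> R (- \<xi>))) \<one> (\<lambda>\<eta>. - dretr_inv G A R (- \<xi>) (- \<eta>))"
    by (rule has_mderiv_compose_flat[OF atlas retr_inv_inverse_mult_has_mderiv[OF minus_mem[OF \<xi>]]])
       (auto intro!: derivative_intros)
  moreover have "(\<lambda>\<eta>. - dretr_inv G A R (- \<xi>) (- \<eta>)) = dretr_inv G A R (- \<xi>)"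
    using has_mderiv_bounded_linear[OF dretr_inv_has_mderiv[OF minus_mem[OF \<xi>]]]
    by (simp add: linear_simps)
  ultimately have *: "has_mderiv A flat_atlas (\<lambda>x. - Q (inv x \<otimes> R (- \<xi>))) \<one> (dretr_inv G A R (- \<xi>))"
    by simp
  have "isCont (\<lambda>x. R \<xi> \<otimes> x) \<one>"
    using left_translation_mdifferentiable by (simp add: mdifferentiable_def)
  then have "eventually (\<lambda>x. R \<xi> \<otimes> x \<in> R ` U) (nhds \<one>)"
    by (rule eventually_isCont) (use open_retr_image \<xi> in \<open>auto simp: eventually_nhds\<close>)
  \<comment> \<open>\<open>inv x \<otimes> R (- \<xi>)\<close> is the inverse of
    \<open>R \<xi> \<otimes> x\<close>. As \<open>Q\<close> turns inverses into negatives on the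
    image of \<open>U\<close>, the agreement is claimed near the identity.\<close>
  then have "eventually (\<lambda>x. - Q (inv x \<otimes> R (- \<xi>)) = Q (R \<xi> \<otimes> x)) (nhds \<one>)"
  proof eventually_elim
    case (elim x)
    have "inv x \<otimes> R (- \<xi>) = R (- Q (R \<xi> \<otimes> x))"
      using elim by (simp add: R_minus \<xi> Q_mem R_Q inv_mult_group)
    then show ?case
      using elim by (simp add: Q_R minus_mem Q_mem)
  qed
  then show ?thesis
    by (rule has_mderiv_cong[OF atlas *])
qed

end

section \<open>Representations\<close>

lemma is_lie_exp_curve:
  assumes "lie_group G A" "is_lie_exp G A E"
  shows "E 0 = \<one>\<^bsub>G\<^esub>" and "has_mderiv flat_atlas A (\<lambda>t::real. E (t *\<^sub>R \<xi>)) 0 (\<lambda>s. s *\<^sub>R \<xi>)"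
proof -
  interpret group G
    using assms by (simp add: lie_group_def)
  \<comment> \<open>\<open>E 0\<close> is idempotent in a group, hence the identity.\<close>
  have "E ((0 + 0) *\<^sub>R \<xi>) = E (0 *\<^sub>R \<xi>) \<otimes>\<^bsub>G\<^esub> E (0 *\<^sub>R \<xi>)"
    using assms(2) unfolding is_lie_exp_def by blast
  then show "E 0 = \<one>\<^bsub>G\<^esub>"
    using assms(1) by (simp add: lie_group_def)
  let ?D = "mderiv flat_atlas A (\<lambda>t::real. E (t *\<^sub>R \<xi>)) 0"
  have D: "has_mderiv flat_atlas A (\<lambda>t::real. E (t *\<^sub>R \<xi>)) 0 ?D" and D1: "?D 1 = \<xi>"
    using assms(2) mdifferentiable_has_mderiv unfolding is_lie_exp_def by blast+
  have "?D s = s *\<^sub>R \<xi>" for s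
    using linear_simps(5)[OF has_mderiv_bounded_linear[OF D], of s 1] D1 by simp
  then have "?D = (\<lambda>s. s *\<^sub>R \<xi>)"
    by (rule ext)
  with D show "has_mderiv flat_atlas A (\<lambda>t::real. E (t *\<^sub>R \<xi>)) 0 (\<lambda>s. s *\<^sub>R \<xi>)"
    by simp
qed

text \<open>The derivative along exponential curves in \<open>inf_rep\<close> is a full tangent map
  at the identity. Hence \<open>inf_rep\<close> is linear in \<open>\<xi>\<close> and can be
  computed along any curve with velocity \<open>\<xi>\<close>.\<close>

lemma rep_has_mderiv:
  assumes "lie_group G A" "is_lie_exp G A E" "left_representation G A \<rho>"
  shows "has_mderiv A flat_atlas (\<lambda>x. \<rho> x v) \<one>\<^bsub>G\<^esub> (\<lambda>\<xi>. inf_rep \<rho> E \<xi> v)"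
proof -
  have A: "diff_atlas A"
    using assms(1) by (simp add: lie_group_def analytic_atlas_imp_diff_atlas)
  have D: "has_mderiv A flat_atlas (\<lambda>x. \<rho> x v) \<one>\<^bsub>G\<^esub> (mderiv A flat_atlas (\<lambda>x. \<rho> x v) \<one>\<^bsub>G\<^esub>)"
    using assms(3) unfolding left_representation_def
    by (intro mdifferentiable_has_mderiv
      map_of_class_mdifferentiable[OF A diff_atlas_flat _ _ smooth_on_differentiable]) auto
  have "inf_rep \<rho> E \<xi> v = mderiv A flat_atlas (\<lambda>x. \<rho> x v) \<one>\<^bsub>G\<^esub> \<xi>" for \<xi>
    unfolding inf_rep_def
    by (rule vector_derivative_at[OF has_mderiv_curve[OF A is_lie_exp_curve(2)[OF assms(1,2)]]])
       (simp add: is_lie_exp_curve(1)[OF assms(1,2)] D)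
  then have "(\<lambda>\<xi>. inf_rep \<rho> E \<xi> v) = mderiv A flat_atlas (\<lambda>x. \<rho> x v) \<one>\<^bsub>G\<^esub>"
    by (rule ext)
  with D show ?thesis
    by simp
qed

text \<open>Expansion in the dual basis; it reduces differentiating a curve of covectors to
  differentiating finitely many evaluations.\<close>

lemma blinfun_dual_expansion:
  fixes \<beta> :: "'v::euclidean_space \<Rightarrow>\<^sub>L real"
  shows "\<beta> = (\<Sum>b\<in>Basis. \<beta> b *\<^sub>R blinfun_inner_left b)"
proof (rule blinfun_eqI)
  fix x
  have "\<beta> x = \<beta> (\<Sum>b\<in>Basis. (x \<bullet> b) *\<^sub>R b)"
    by (simp add: euclidean_representation)
  then show "\<beta> x = (\<Sum>b\<in>Basis. \<beta> b *\<^sub>R blinfun_inner_left b) x"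
    by (simp only: blinfun.sum_right blinfun.sum_left blinfun.scaleR_right blinfun.scaleR_left
        blinfun_inner_left.rep_eq real_scaleR_def mult.commute)
qed

text \<open>The transported covector moves with the infinitesimal action on \<open>\<alpha>\<close>;
  pairing this velocity with the gradient \<open>w\<close> of \<open>F\<close> gives the momentum
  map of \<open>w\<close> and \<open>\<alpha>\<close>, evaluated at \<open>\<eta>\<close>.\<close>

lemma dual_rep_curve_derivative:
  fixes F :: "('v::euclidean_space \<Rightarrow>\<^sub>L real) \<Rightarrow> real"
  assumes lie: "lie_group G A" "is_lie_exp G A E" "left_representation G A \<rho>"
    and \<phi>: "has_mderiv flat_atlas A \<phi> 0 (\<lambda>s::real. s *\<^sub>R \<eta>)" "\<phi> 0 = \<one>\<^bsub>G\<^esub>"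
    and F: "(F has_derivative (\<lambda>\<beta>. blinfun_apply \<beta> w)) (at \<alpha>)"
  shows "((\<lambda>\<epsilon>. F (dual_rep \<rho> (\<phi> \<epsilon>) \<alpha>)) has_real_derivative \<alpha> (inf_rep \<rho> E \<eta> w)) (at 0)"
proof -
  have A: "diff_atlas A"
    using lie(1) by (simp add: lie_group_def analytic_atlas_imp_diff_atlas)
  have pointwise: "((\<lambda>\<epsilon>. \<alpha> (\<rho> (\<phi> \<epsilon>) v)) has_vector_derivative \<alpha> (inf_rep \<rho> E \<eta> v)) (at 0)" for v
    by (rule bounded_linear.has_vector_derivative[OF blinfun.bounded_linear_right],
        rule has_mderiv_curve[OF A \<phi>(1)]) (simp add: \<phi>(2) rep_has_mderiv[OF lie])
  let ?\<beta>' = "\<Sum>b\<in>Basis. \<alpha> (inf_rep \<rho> E \<eta> b) *\<^sub>R blinfun_inner_left b"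
  have expansion: "(\<lambda>\<epsilon>. dual_rep \<rho> (\<phi> \<epsilon>) \<alpha>) =
      (\<lambda>\<epsilon>. \<Sum>b\<in>Basis. \<alpha> (\<rho> (\<phi> \<epsilon>) b) *\<^sub>R blinfun_inner_left b)"
    by (rule ext, subst blinfun_dual_expansion) (simp add: dual_rep_def)
  have curve: "((\<lambda>\<epsilon>. dual_rep \<rho> (\<phi> \<epsilon>) \<alpha>) has_vector_derivative ?\<beta>') (at 0)"
    unfolding expansion
    by (intro has_vector_derivative_sum
        bounded_linear.has_vector_derivative[OF bounded_linear_scaleR_left] pointwise)
  have "((\<lambda>\<epsilon>. dual_rep \<rho> (\<phi> \<epsilon>) \<alpha> w) has_vector_derivative ?\<beta>' w) (at 0)"
    by (rule bounded_linear.has_vector_derivative[OF blinfun.bounded_linear_left curve])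
  \<comment> \<open>Uniqueness of the derivative of the evaluation at \<open>w\<close> computes the
    basis sum there, without appeal to linearity of \<open>inf_rep\<close> in its vector
    argument.\<close>
  then have \<beta>'_w: "?\<beta>' w = \<alpha> (inf_rep \<rho> E \<eta> w)"
    using vector_derivative_unique_at[OF _ pointwise[of w]] by (simp add: dual_rep_def)
  have "dual_rep \<rho> (\<phi> 0) \<alpha> = \<alpha>"
    using lie(3) by (simp add: \<phi>(2) left_representation_def dual_rep_def blinfun_eqI)
  then have "(F has_derivative (\<lambda>\<beta>. blinfun_apply \<beta> w)) (at (dual_rep \<rho> (\<phi> 0) \<alpha>))"
    using F by simp
  from diff_chain_at[OF curve[unfolded has_vector_derivative_def] this]
  have "((\<lambda>\<epsilon>. F (dual_rep \<rho> (\<phi> \<epsilon>) \<alpha>)) has_derivative (\<lambda>\<epsilon>. \<epsilon> *\<^sub>R ?\<beta>' w)) (at 0)"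
    by (simp only: comp_def blinfun.scaleR_left)
  then show ?thesis
    unfolding \<beta>'_w by (simp only: has_real_derivative_iff_has_vector_derivative has_vector_derivative_def)
qed

text \<open>Finite dimension identifies the bidual with \<open>V\<close>: the differential, a
  functional on covectors, is evaluation at a single vector, so the description in
  \<open>d_obst\<close> is well posed.\<close>

lemma d_obst_has_derivative:
  assumes "obst_ext P i \<one>\<^bsub>grp P\<^esub> differentiable (at \<alpha>)"
  shows "(obst_ext P i \<one>\<^bsub>grp P\<^esub> has_derivative (\<lambda>\<beta>. blinfun_apply \<beta> (d_obst P i \<alpha>))) (at \<alpha>)"
proof -
  let ?F = "obst_ext P i \<one>\<^bsub>grp P\<^esub>"
  obtain D where D: "(?F has_derivative D) (at \<alpha>)"
    using assms by (auto simp: differentiable_def)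
  \<comment> \<open>The coordinates of the representing vector are the values of \<open>D\<close> on
    the dual basis.\<close>
  define v where "v = (\<Sum>b\<in>Basis. D (blinfun_inner_left b) *\<^sub>R b)"
  have "D \<beta> = \<beta> v" for \<beta>
    using has_derivative_linear[OF D] unfolding v_def
    by (subst blinfun_dual_expansion[of \<beta>])
       (simp add: linear_sum linear_scale blinfun.sum_right blinfun.scaleR_right mult.commute)
  then have "D = (\<lambda>\<beta>. blinfun_apply \<beta> v)"
    by (rule ext)
  with D have v: "(?F has_derivative (\<lambda>\<beta>. blinfun_apply \<beta> v)) (at \<alpha>)"
    by (simp only:)
  have "d_obst P i \<alpha> = v"
    unfolding d_obst_def
  proof (rule the_equality)
    show "(?F has_derivative (\<lambda>\<beta>. blinfun_apply \<beta> v)) (at \<alpha>)"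
      by (rule v)
  next
    fix w assume "(?F has_derivative (\<lambda>\<beta>. blinfun_apply \<beta> w)) (at \<alpha>)"
    \<comment> \<open>Two representing vectors are compared on the covector dual to their
      difference.\<close>
    from fun_cong[OF has_derivative_unique[OF this v], of "blinfun_inner_left (w - v)"]
    have "(w - v) \<bullet> (w - v) = 0"
      by (simp add: inner_diff_left)
    then show "w = v"
      by simp
  qed
  with v show ?thesis
    by simp
qed

section \<open>Stationarity of the action\<close>

text \<open>Invariance turns both discrete Lagrangians into this form; they differ in the collision terms
  \<open>K\<close> only.\<close>

definition action ::
    "('g, 'e::euclidean_space, 'v::euclidean_space) control_problem \<Rightarrow> (nat \<Rightarrow> (nat \<Rightarrow> 'g) \<Rightarrow> real) \<Rightarrow>
     (nat \<Rightarrow> nat \<Rightarrow> 'e \<Rightarrow>\<^sub>L real) \<Rightarrow> (nat \<Rightarrow> nat \<Rightarrow> 'g) \<Rightarrow> (nat \<Rightarrow> nat \<Rightarrow> 'e) \<Rightarrow> real" where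
  "action P K \<mu> g u = (\<Sum>k<nsteps P. tstep P * (\<Sum>i\<in>agents P.
     cost P i \<one>\<^bsub>grp P\<^esub> (u k i) + obst_ext P i \<one>\<^bsub>grp P\<^esub> (advected P (g k) i) +
     \<mu> k i ((1 / tstep P) *\<^sub>R retr_inv P (rel_step P (g k) (g (Suc k)) i) - u k i) + K i (g k)))"

section \<open>Reduction of the Lagrangians by invariance\<close>

lemma sum_reduced_aug_lagrangian:
  "(\<Sum>k<nsteps P. reduced_aug_lagrangian P (g k) (rel_step P (g k) (g (Suc k))) (u k) (\<mu> k)
      (advected P (g k))) = action P (\<lambda>l q. coll_total P l (pin_first P q)) \<mu> g u"
  by (simp add: action_def reduced_aug_lagrangian_def)

text \<open>The order reverses because the dual is a right action; this is the source of the
  advection equation.\<close>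

lemma dual_rep_mult:
  "left_representation G A \<rho> \<Longrightarrow> dual_rep \<rho> (x \<otimes>\<^bsub>G\<^esub> y) \<alpha> = dual_rep \<rho> y (dual_rep \<rho> x \<alpha>)"
  by (rule blinfun_eqI) (simp add: left_representation_def dual_rep_def)

lemma sum_aug_lagrangian:
  assumes "standing_assumptions P"
  shows "(\<Sum>k<nsteps P. aug_lagrangian P (g k) (g (Suc k)) (u k) (\<mu> k)) = action P (coll_total P) \<mu> g u"
proof -
  have lie: "lie_group (grp P) (atl P)" and rep: "left_representation (grp P) (atl P) (rep P)"
    using assms unfolding standing_assumptions_def by blast+
  interpret group "grp P"
    using lie by (simp add: lie_group_def)
  have carrier: "carrier (grp P) = UNIV"
    using lie by (simp add: lie_group_def)
  have cost: "cost P i x w = cost P i \<one>\<^bsub>grp P\<^esub> w" if "i \<in> agents P" for i x w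
  proof -
    have "cost P i (x \<otimes>\<^bsub>grp P\<^esub> \<one>\<^bsub>grp P\<^esub>) w = cost P i \<one>\<^bsub>grp P\<^esub> w"
      using assms that unfolding standing_assumptions_def by blast
    then show ?thesis
      by (simp add: carrier)
  qed
  have obst: "obst P i x = obst_ext P i \<one>\<^bsub>grp P\<^esub> (dual_rep (rep P) x (alpha0 P i))"
    if "i \<in> agents P" for i x
  proof -
    \<comment> \<open>Transport by \<open>inv x\<close> undoes transport by \<open>x\<close>, so
      equivariance applied to the advected parameter moves the base point \<open>x\<close> to the
      identity.\<close>
    have dual: "dual_rep (rep P) (inv\<^bsub>grp P\<^esub> x) (dual_rep (rep P) x (alpha0 P i)) = alpha0 P i"
      using rep by (simp add: dual_rep_mult[OF rep, symmetric] carrier)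
        (simp add: left_representation_def dual_rep_def blinfun_eqI)
    have "obst_ext P i (x \<otimes>\<^bsub>grp P\<^esub> \<one>\<^bsub>grp P\<^esub>)
        (dual_rep (rep P) (inv\<^bsub>grp P\<^esub> x) (dual_rep (rep P) x (alpha0 P i))) =
        obst_ext P i \<one>\<^bsub>grp P\<^esub> (dual_rep (rep P) x (alpha0 P i))"
      using assms that unfolding standing_assumptions_def by blast
    moreover have "obst_ext P i x (alpha0 P i) = obst P i x"
      using assms that unfolding standing_assumptions_def by blast
    ultimately show ?thesis
      by (simp add: dual carrier)
  qed
  show ?thesis
    unfolding action_def aug_lagrangian_def
    by (intro sum.cong refl arg_cong2[where f = times]) (simp add: cost[of _ "g _ _"] obst advected_def)
qed

text \<open>Moving one agent at an interior step leaves both endpoints fixed; the position follows a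
  given curve and the control an independent straight line.\<close>

lemma single_agent_variation:
  assumes A: "diff_atlas (atl P)" and i: "i \<in> agents P" and k: "k \<in> {1..<nsteps P}"
    and \<gamma>: "\<gamma> 0 = g k i" "\<delta> > 0" "map_of_class smooth_on flat_atlas (atl P) \<gamma> {-\<delta><..<\<delta>}"
  shows "variation P g u (\<lambda>\<epsilon>. g(k := (g k)(i := \<gamma> \<epsilon>))) (\<lambda>\<epsilon>. u(k := (u k)(i := u k i + \<epsilon> *\<^sub>R w)))"
proof -
  have "\<exists>\<delta>>0. map_of_class smooth_on flat_atlas (atl P) (\<lambda>\<epsilon>. (g(k := (g k)(i := \<gamma> \<epsilon>))) k' i') {-\<delta><..<\<delta>} \<and>
      smooth_on (\<lambda>\<epsilon>. (u(k := (u k)(i := u k i + \<epsilon> *\<^sub>R w))) k' i') {-\<delta><..<\<delta>}" for k' i'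
    using \<gamma>(2,3)
    by (cases "k' = k"; cases "i' = i")
       (auto intro!: exI[of _ \<delta>] smooth_on_affine map_of_class_const[OF A] smooth_on_const)
  then show ?thesis
    using \<gamma>(1) k unfolding variation_def by auto
qed

text \<open>The varied point enters two increments, the one leaving it and the one arriving from
  step \<open>k - 1\<close>, while \<open>K l\<close> may respond for every \<open>l\<close> because
  it sees the whole configuration. Prescribing the velocity of \<open>\<gamma>\<close> as a left
  translate of \<open>\<eta>\<close> expresses the result in the Lie algebra.\<close>

lemma action_derivative:
  fixes P :: "('g::{metric_space, second_countable_topology}, 'e::euclidean_space,
      'v::euclidean_space) control_problem"
  assumes std: "standing_assumptions P" and diff: "differentiable_along P g u"
    and feas: "feasible P g u" and i: "i \<in> agents P" and k: "k \<in> {1..<nsteps P}"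
    and \<gamma>: "\<gamma> 0 = g k i"
      "has_mderiv flat_atlas (atl P) \<gamma> 0
         (\<lambda>s::real. s *\<^sub>R mderiv (atl P) (atl P) (\<lambda>x. g k i \<otimes>\<^bsub>grp P\<^esub> x) \<one>\<^bsub>grp P\<^esub> \<eta>)"
    and K: "\<And>l. l \<in> agents P \<Longrightarrow>
      has_mderiv (atl P) flat_atlas (\<lambda>x. K l ((g k)(i := x))) (g k i) (DK l)"
  shows "((\<lambda>\<epsilon>. action P K \<mu> (g(k := (g k)(i := \<gamma> \<epsilon>))) (u(k := (u k)(i := u k i + \<epsilon> *\<^sub>R w))))
    has_real_derivative tstep P * (frechet_derivative (cost P i \<one>\<^bsub>grp P\<^esub>) (at (u k i)) w
      + advected P (g k) i (inf_rep (rep P) (lexp P) \<eta> (d_obst P i (advected P (g k) i)))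
      + \<mu> k i ((1 / tstep P) *\<^sub>R dretr_inv (grp P) (atl P) (retr P) (tstep P *\<^sub>R u k i) (- \<eta>) - w)
      + \<mu> (k - 1) i ((1 / tstep P) *\<^sub>R
          dretr_inv (grp P) (atl P) (retr P) (- (tstep P *\<^sub>R u (k - 1) i)) \<eta>)
      + (\<Sum>l\<in>agents P. DK l (mderiv (atl P) (atl P) (\<lambda>x. g k i \<otimes>\<^bsub>grp P\<^esub> x) \<one>\<^bsub>grp P\<^esub> \<eta>)))) (at 0)"
proof -
  let ?h = "tstep P" and ?U = "retr_dom P" and ?R = "retr P"
  let ?a = "g k i" and ?\<alpha> = "advected P (g k) i"
  let ?v = "mderiv (atl P) (atl P) (\<lambda>x. g k i \<otimes>\<^bsub>grp P\<^esub> x) \<one>\<^bsub>grp P\<^esub> \<eta>"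
  have lie: "lie_group (grp P) (atl P)" and exp: "is_lie_exp (grp P) (atl P) (lexp P)"
    and rep: "left_representation (grp P) (atl P) (rep P)"
    and retr: "retraction_map (grp P) (atl P) ?U ?R"
    using std unfolding standing_assumptions_def by blast+
  interpret G: retracted_lie_group "grp P" "atl P" ?U ?R
    using lie retr by unfold_locales
  note A = G.atlas
  have step: "g (Suc j) i = g j i \<otimes>\<^bsub>grp P\<^esub> ?R (?h *\<^sub>R u j i)" and dom: "?h *\<^sub>R u j i \<in> ?U"
    if "j < nsteps P" for j
    using feas i that unfolding feasible_def by blast+
  obtain k\<^sub>0 where k0: "k = Suc k\<^sub>0"
    using k by (cases k) auto
  have k_less: "k < nsteps P" "k\<^sub>0 < nsteps P"
    using k k0 by auto
  \<comment> \<open>The left-trivialized variation, a curve through the identity with velocity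
    \<open>\<eta>\<close>.\<close>
  define \<phi> where "\<phi> = (\<lambda>\<epsilon>. inv\<^bsub>grp P\<^esub> ?a \<otimes>\<^bsub>grp P\<^esub> \<gamma> \<epsilon>)"
  have \<gamma>_\<phi>: "\<gamma> \<epsilon> = ?a \<otimes>\<^bsub>grp P\<^esub> \<phi> \<epsilon>" for \<epsilon>
    by (simp add: \<phi>_def G.m_assoc[symmetric])
  have \<phi>0: "\<phi> 0 = \<one>\<^bsub>grp P\<^esub>"
    by (simp add: \<phi>_def \<gamma>(1))
  have \<phi>: "has_mderiv flat_atlas (atl P) \<phi> 0 (\<lambda>s. s *\<^sub>R \<eta>)"
  proof -
    have T: "has_mderiv (atl P) (atl P) (\<lambda>x. inv\<^bsub>grp P\<^esub> ?a \<otimes>\<^bsub>grp P\<^esub> x) ?a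
        (mderiv (atl P) (atl P) (\<lambda>x. inv\<^bsub>grp P\<^esub> ?a \<otimes>\<^bsub>grp P\<^esub> x) ?a)"
      by (rule mdifferentiable_has_mderiv[OF G.left_translation_mdifferentiable])
    have "has_mderiv flat_atlas (atl P) \<phi> 0
        (\<lambda>s. mderiv (atl P) (atl P) (\<lambda>x. inv\<^bsub>grp P\<^esub> ?a \<otimes>\<^bsub>grp P\<^esub> x) ?a (s *\<^sub>R ?v))"
      unfolding \<phi>_def by (rule has_mderiv_chain[OF diff_atlas_flat A \<gamma>(2)]) (simp only: \<gamma>(1) T)
    then show ?thesis
      by (simp add: linear_simps(5)[OF has_mderiv_bounded_linear[OF T]] G.mderiv_left_translation_inverse)
  qed
  \<comment> \<open>\<open>X\<close> collects the response of agent \<open>i\<close> at step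
    \<open>k\<close> apart from \<open>K\<close>, \<open>Y\<close> that of its constraint term at
    the preceding step.\<close>
  define X where "X = frechet_derivative (cost P i \<one>\<^bsub>grp P\<^esub>) (at (u k i)) w
      + ?\<alpha> (inf_rep (rep P) (lexp P) \<eta> (d_obst P i ?\<alpha>))
      + \<mu> k i ((1 / ?h) *\<^sub>R dretr_inv (grp P) (atl P) ?R (?h *\<^sub>R u k i) (- \<eta>) - w)"
  define Y where "Y = \<mu> k\<^sub>0 i ((1 / ?h) *\<^sub>R dretr_inv (grp P) (atl P) ?R (- (?h *\<^sub>R u k\<^sub>0 i)) \<eta>)"
  have cost: "((\<lambda>\<epsilon>. cost P i \<one>\<^bsub>grp P\<^esub> (u k i + \<epsilon> *\<^sub>R w)) has_real_derivative
      frechet_derivative (cost P i \<one>\<^bsub>grp P\<^esub>) (at (u k i)) w) (at 0)"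
  proof -
    have D: "(cost P i \<one>\<^bsub>grp P\<^esub> has_derivative frechet_derivative (cost P i \<one>\<^bsub>grp P\<^esub>) (at (u k i))) (at (u k i))"
      using diff i k unfolding differentiable_along_def by (simp add: frechet_derivative_works)
    have "((\<lambda>\<epsilon>. u k i + \<epsilon> *\<^sub>R w) has_derivative (\<lambda>\<epsilon>::real. \<epsilon> *\<^sub>R w)) (at 0)"
      by (auto intro!: derivative_eq_intros)
    from has_derivative_compose[OF this, of "cost P i \<one>\<^bsub>grp P\<^esub>"] D
    have "((\<lambda>\<epsilon>. cost P i \<one>\<^bsub>grp P\<^esub> (u k i + \<epsilon> *\<^sub>R w)) has_derivative
        (\<lambda>\<epsilon>. frechet_derivative (cost P i \<one>\<^bsub>grp P\<^esub>) (at (u k i)) (\<epsilon> *\<^sub>R w))) (at 0)"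
      by simp
    then show ?thesis
      by (simp add: linear_simps(5)[OF has_derivative_bounded_linear[OF D]]
          has_real_derivative_iff_has_vector_derivative has_vector_derivative_def)
  qed
  have obst: "((\<lambda>\<epsilon>. obst_ext P i \<one>\<^bsub>grp P\<^esub> (dual_rep (rep P) (\<gamma> \<epsilon>) (alpha0 P i))) has_real_derivative
      ?\<alpha> (inf_rep (rep P) (lexp P) \<eta> (d_obst P i ?\<alpha>))) (at 0)"
  proof -
    have "dual_rep (rep P) (\<gamma> \<epsilon>) (alpha0 P i) = dual_rep (rep P) (\<phi> \<epsilon>) ?\<alpha>" for \<epsilon>
      by (simp add: \<gamma>_\<phi> advected_def dual_rep_mult[OF rep])
    moreover have "(obst_ext P i \<one>\<^bsub>grp P\<^esub> has_derivative (\<lambda>\<beta>. blinfun_apply \<beta> (d_obst P i ?\<alpha>))) (at ?\<alpha>)"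
      using diff i k unfolding differentiable_along_def by (intro d_obst_has_derivative) blast
    ultimately show ?thesis
      using dual_rep_curve_derivative[OF lie exp rep \<phi> \<phi>0] by simp
  qed
  \<comment> \<open>By the kinematic equation the leaving increment is the inverse of
    \<open>\<phi> \<epsilon>\<close> times the old one.\<close>
  have out: "((\<lambda>\<epsilon>. retr_inv P (inv\<^bsub>grp P\<^esub> \<gamma> \<epsilon> \<otimes>\<^bsub>grp P\<^esub> g (Suc k) i)) has_vector_derivative
      dretr_inv (grp P) (atl P) ?R (?h *\<^sub>R u k i) (- \<eta>)) (at 0)"
  proof -
    have "inv\<^bsub>grp P\<^esub> \<gamma> \<epsilon> \<otimes>\<^bsub>grp P\<^esub> g (Suc k) i = inv\<^bsub>grp P\<^esub> \<phi> \<epsilon> \<otimes>\<^bsub>grp P\<^esub> ?R (?h *\<^sub>R u k i)" for \<epsilon>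
    proof -
      have "inv\<^bsub>grp P\<^esub> \<gamma> \<epsilon> \<otimes>\<^bsub>grp P\<^esub> g (Suc k) i =
          inv\<^bsub>grp P\<^esub> \<phi> \<epsilon> \<otimes>\<^bsub>grp P\<^esub> (inv\<^bsub>grp P\<^esub> ?a \<otimes>\<^bsub>grp P\<^esub> ?a \<otimes>\<^bsub>grp P\<^esub> ?R (?h *\<^sub>R u k i))"
        by (simp only: \<gamma>_\<phi> step[OF k_less(1)] G.inv_mult_group G.m_assoc G.m_closed G.inv_closed
            G.carrier_UNIV UNIV_I)
      then show ?thesis
        by simp
    qed
    then show ?thesis
      using has_mderiv_curve[OF A \<phi>, of "\<lambda>x. retr_inv P (inv\<^bsub>grp P\<^esub> x \<otimes>\<^bsub>grp P\<^esub> ?R (?h *\<^sub>R u k i))"]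
        G.retr_inv_inverse_mult_has_mderiv[OF dom[OF k_less(1)]] by (simp add: \<phi>0)
  qed
  \<comment> \<open>The arriving increment is the old one times \<open>\<phi> \<epsilon>\<close>; a
    right factor is what produces the negated argument of \<open>dretr_inv\<close>.\<close>
  have into: "((\<lambda>\<epsilon>. retr_inv P (inv\<^bsub>grp P\<^esub> g k\<^sub>0 i \<otimes>\<^bsub>grp P\<^esub> \<gamma> \<epsilon>)) has_vector_derivative
      dretr_inv (grp P) (atl P) ?R (- (?h *\<^sub>R u k\<^sub>0 i)) \<eta>) (at 0)"
  proof -
    have "inv\<^bsub>grp P\<^esub> g k\<^sub>0 i \<otimes>\<^bsub>grp P\<^esub> \<gamma> \<epsilon> = ?R (?h *\<^sub>R u k\<^sub>0 i) \<otimes>\<^bsub>grp P\<^esub> \<phi> \<epsilon>" for \<epsilon>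
      using step[OF k_less(2)] by (simp add: \<gamma>_\<phi> k0 G.m_assoc[symmetric])
    then show ?thesis
      using has_mderiv_curve[OF A \<phi>, of "\<lambda>x. retr_inv P (?R (?h *\<^sub>R u k\<^sub>0 i) \<otimes>\<^bsub>grp P\<^esub> x)"]
        G.retr_inv_mult_has_mderiv[OF dom[OF k_less(2)]] by (simp add: \<phi>0)
  qed
  have coll: "((\<lambda>\<epsilon>. K l ((g k)(i := \<gamma> \<epsilon>))) has_real_derivative DK l ?v) (at 0)" if "l \<in> agents P" for l
    using has_mderiv_curve[OF A \<gamma>(2), of "\<lambda>x. K l ((g k)(i := x))"] K[OF that] \<gamma>(1)
    by (simp add: has_real_derivative_iff_has_vector_derivative)
  have multiplier: "((\<lambda>\<epsilon>. m (f \<epsilon>)) has_real_derivative m f') (at 0)"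
    if "(f has_vector_derivative f') (at 0)" for m :: "'e \<Rightarrow>\<^sub>L real" and f f'
    unfolding has_real_derivative_iff_has_vector_derivative
    by (rule bounded_linear.has_vector_derivative[OF blinfun.bounded_linear_right that])
  let ?g = "\<lambda>\<epsilon>. g(k := (g k)(i := \<gamma> \<epsilon>))" and ?u = "\<lambda>\<epsilon>. u(k := (u k)(i := u k i + \<epsilon> *\<^sub>R w))"
  \<comment> \<open>Derivatives of all summands at once: \<open>X\<close> and \<open>Y\<close>
    belong to agent \<open>i\<close> alone, the \<open>K\<close> terms respond for all agents at
    step \<open>k\<close>.\<close>
  let ?d = "\<lambda>k' l. (if k' = k \<and> l = i then X else 0) + (if k' = k\<^sub>0 \<and> l = i then Y else 0)
      + (if k' = k then DK l ?v else 0)"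
  have summand: "((\<lambda>\<epsilon>. cost P l \<one>\<^bsub>grp P\<^esub> (?u \<epsilon> k' l) + obst_ext P l \<one>\<^bsub>grp P\<^esub> (advected P (?g \<epsilon> k') l)
      + \<mu> k' l ((1 / ?h) *\<^sub>R retr_inv P (rel_step P (?g \<epsilon> k') (?g \<epsilon> (Suc k')) l) - ?u \<epsilon> k' l)
      + K l (?g \<epsilon> k')) has_real_derivative ?d k' l) (at 0)" if l: "l \<in> agents P" for k' l
  proof -
    consider (here) "k' = k" "l = i" | (others) "k' = k" "l \<noteq> i" | (before) "k' = k\<^sub>0" "l = i"
      | (rest) "k' \<noteq> k" "k' = k\<^sub>0 \<longrightarrow> l \<noteq> i"
      by blast
    then show ?thesis
    proof cases
      case here
      have "((\<lambda>\<epsilon>. u k i + \<epsilon> *\<^sub>R w) has_vector_derivative w) (at 0)"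
        by (auto intro!: derivative_eq_intros simp: has_vector_derivative_def)
      then have "((\<lambda>\<epsilon>. (1 / ?h) *\<^sub>R retr_inv P (inv\<^bsub>grp P\<^esub> \<gamma> \<epsilon> \<otimes>\<^bsub>grp P\<^esub> g (Suc k) i) - (u k i + \<epsilon> *\<^sub>R w))
          has_vector_derivative (1 / ?h) *\<^sub>R dretr_inv (grp P) (atl P) ?R (?h *\<^sub>R u k i) (- \<eta>) - w) (at 0)"
        by (intro has_vector_derivative_diff bounded_linear.has_vector_derivative[OF bounded_linear_scaleR_right] out)
      from DERIV_add[OF DERIV_add[OF DERIV_add[OF cost obst] multiplier[OF this, of "\<mu> k i"]] coll[OF i]]
      show ?thesis
        using here k0 by (simp add: X_def advected_def)
    next
      case others
      then show ?thesis
        using DERIV_add[OF DERIV_const coll[OF l]] by (simp add: advected_def k0)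
    next
      case before
      have "((\<lambda>\<epsilon>. (1 / ?h) *\<^sub>R retr_inv P (inv\<^bsub>grp P\<^esub> g k\<^sub>0 i \<otimes>\<^bsub>grp P\<^esub> \<gamma> \<epsilon>) - u k\<^sub>0 i)
          has_vector_derivative (1 / ?h) *\<^sub>R dretr_inv (grp P) (atl P) ?R (- (?h *\<^sub>R u k\<^sub>0 i)) \<eta> - 0) (at 0)"
        by (intro has_vector_derivative_diff has_vector_derivative_const
            bounded_linear.has_vector_derivative[OF bounded_linear_scaleR_right] into)
      from DERIV_add[OF DERIV_add[OF DERIV_const multiplier[OF this, of "\<mu> k\<^sub>0 i"]] DERIV_const]
      show ?thesis
        by (simp add: before Y_def k0)
    next
      \<comment> \<open>No \<open>\<epsilon>\<close> survives the updates; at the preceding step the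
        increments of the other agents end at unvaried points.\<close>
      case rest
      have "(\<lambda>\<epsilon>. cost P l \<one>\<^bsub>grp P\<^esub> (?u \<epsilon> k' l) + obst_ext P l \<one>\<^bsub>grp P\<^esub> (advected P (?g \<epsilon> k') l)
          + \<mu> k' l ((1 / ?h) *\<^sub>R retr_inv P (rel_step P (?g \<epsilon> k') (?g \<epsilon> (Suc k')) l) - ?u \<epsilon> k' l)
          + K l (?g \<epsilon> k')) =
        (\<lambda>\<epsilon>. cost P l \<one>\<^bsub>grp P\<^esub> (u k' l) + obst_ext P l \<one>\<^bsub>grp P\<^esub> (advected P (g k') l)
          + \<mu> k' l ((1 / ?h) *\<^sub>R retr_inv P (rel_step P (g k') (g (Suc k')) l) - u k' l) + K l (g k'))"
        using rest by (auto simp: k0)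
      then show ?thesis
        using rest by auto
    qed
  qed
  have inner: "(\<Sum>l\<in>agents P. ?d k' l) = (if k' = k then X + (\<Sum>l\<in>agents P. DK l ?v) else 0)
      + (if k' = k\<^sub>0 then Y else 0)" for k'
    using i by (cases "k' = k"; cases "k' = k\<^sub>0") (simp_all add: sum.distrib k0)
  have "(\<Sum>k'<nsteps P. \<Sum>l\<in>agents P. ?d k' l) = X + Y + (\<Sum>l\<in>agents P. DK l ?v)"
    unfolding inner using k_less by (simp add: sum.distrib)
  then have "(\<Sum>k'<nsteps P. ?h * (\<Sum>l\<in>agents P. ?d k' l)) = ?h * (X + Y + (\<Sum>l\<in>agents P. DK l ?v))"
    by (simp only: sum_distrib_left[symmetric])
  moreover have "((\<lambda>\<epsilon>. action P K \<mu> (?g \<epsilon>) (?u \<epsilon>)) has_real_derivative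
      (\<Sum>k'<nsteps P. ?h * (\<Sum>l\<in>agents P. ?d k' l))) (at 0)"
    unfolding action_def by (intro DERIV_sum DERIV_cmult summand)
  ultimately show ?thesis
    by (simp add: X_def Y_def k0 algebra_simps)
qed

text \<open>Both sides are the tangent map of one and the same map, so uniqueness applies. This
  moves the step size into the first slot of the momentum map.\<close>

lemma inf_rep_scaleR:
  assumes "lie_group G A" "is_lie_exp G A E" "left_representation G A \<rho>"
  shows "inf_rep \<rho> E \<xi> (c *\<^sub>R v) = c *\<^sub>R inf_rep \<rho> E \<xi> v"
proof -
  have A: "diff_atlas A"
    using assms(1) by (simp add: lie_group_def analytic_atlas_imp_diff_atlas)
  have "has_mderiv A flat_atlas (\<lambda>x. c *\<^sub>R \<rho> x v) \<one>\<^bsub>G\<^esub> (\<lambda>\<xi>. c *\<^sub>R inf_rep \<rho> E \<xi> v)"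
    by (rule has_mderiv_compose_flat[OF A rep_has_mderiv[OF assms]]) (intro derivative_intros)
  moreover have "has_mderiv A flat_atlas (\<lambda>x. c *\<^sub>R \<rho> x v) \<one>\<^bsub>G\<^esub> (\<lambda>\<xi>. inf_rep \<rho> E \<xi> (c *\<^sub>R v))"
    using rep_has_mderiv[OF assms, of "c *\<^sub>R v"] by (simp add: blinfun.scaleR_right)
  ultimately show ?thesis
    using fun_cong[OF has_mderiv_unique] by metis
qed

text \<open>\<open>Blinfun\<close> is meaningful on bounded linear maps; here linearity in
  \<open>\<xi>\<close> holds because \<open>inf_rep\<close> is a tangent map.\<close>

lemma momentum_map_apply:
  assumes "lie_group G A" "is_lie_exp G A E" "left_representation G A \<rho>"
  shows "momentum_map \<rho> E v \<alpha> \<xi> = \<alpha> (inf_rep \<rho> E \<xi> v)"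
  unfolding momentum_map_def
  by (rule bounded_linear_Blinfun_apply[THEN fun_cong],
      rule bounded_linear_compose[OF blinfun.bounded_linear_right
        has_mderiv_bounded_linear[OF rep_has_mderiv[OF assms]]])

lemma dual_map_apply: "bounded_linear L \<Longrightarrow> dual_map L \<phi> x = \<phi> (L x)"
  unfolding dual_map_def
  by (rule bounded_linear_Blinfun_apply[THEN fun_cong],
      rule bounded_linear_compose[OF blinfun.bounded_linear_right])

text \<open>\<open>K\<close> stays general to cover pinned and unpinned collision potentials alike.
  The directions \<open>w\<close> and \<open>\<eta>\<close> are independent: varying
  \<open>w\<close> isolates the multiplier equation, \<open>w = 0\<close> leaves the momentum
  balance.\<close>

lemma stationary_equations:
  fixes P :: "('g::{metric_space, second_countable_topology}, 'e::euclidean_space,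
      'v::euclidean_space) control_problem"
  assumes std: "standing_assumptions P" and diff: "differentiable_along P g u"
    and feas: "feasible P g u"
    and stat: "\<forall>gv uv. variation P g u gv uv \<longrightarrow>
      ((\<lambda>\<epsilon>. action P K \<mu> (gv \<epsilon>) (uv \<epsilon>)) has_real_derivative 0) (at 0)"
    and i: "i \<in> agents P" and k: "k \<in> {1..<nsteps P}"
    and K: "\<forall>l\<in>agents P.
      has_mderiv (atl P) flat_atlas (\<lambda>x. K l ((g k)(i := x))) (g k i) (DK l)"
  shows "\<mu> k i = d_cost P i (u k i)" (is ?cost)
    and "retr_pullback P (tstep P *\<^sub>R u k i) (\<mu> k i) =
      retr_pullback P (- (tstep P *\<^sub>R u (k - 1) i)) (\<mu> (k - 1) i)
      + momentum_map (rep P) (lexp P) (tstep P *\<^sub>R d_obst P i (advected P (g k) i)) (advected P (g k) i)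
      + tstep P *\<^sub>R (\<Sum>l\<in>agents P. left_pullback P (g k i) (Blinfun (DK l)))" (is ?momentum)
proof -
  let ?U = "retr_dom P" and ?R = "retr P" and ?\<alpha> = "advected P (g k) i"
  let ?T = "mderiv (atl P) (atl P) (\<lambda>x. g k i \<otimes>\<^bsub>grp P\<^esub> x) \<one>\<^bsub>grp P\<^esub>"
  let ?D = "frechet_derivative (cost P i \<one>\<^bsub>grp P\<^esub>) (at (u k i))"
  let ?out = "dretr_inv (grp P) (atl P) ?R (tstep P *\<^sub>R u k i)"
    and ?into = "dretr_inv (grp P) (atl P) ?R (- (tstep P *\<^sub>R u (k - 1) i))"
  have lie: "lie_group (grp P) (atl P)" and exp: "is_lie_exp (grp P) (atl P) (lexp P)"
    and rep: "left_representation (grp P) (atl P) (rep P)"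
    and retr: "retraction_map (grp P) (atl P) ?U ?R" and "horizon P > 0" "nsteps P > 0"
    using std unfolding standing_assumptions_def by blast+
  then have h: "tstep P \<noteq> 0"
    by simp
  interpret G: retracted_lie_group "grp P" "atl P" ?U ?R
    using lie retr by unfold_locales
  have dom: "tstep P *\<^sub>R u j i \<in> ?U" if "j < nsteps P" for j
    using feas i that unfolding feasible_def by blast
  \<comment> \<open>The negated step lies in the domain of the retraction because that domain is
    symmetric.\<close>
  have out: "bounded_linear ?out" and into: "bounded_linear ?into"
    using k by (auto intro!: has_mderiv_bounded_linear[OF G.dretr_inv_has_mderiv] G.minus_mem dom)
  have T: "bounded_linear ?T"
    by (rule has_mderiv_bounded_linear[OF mdifferentiable_has_mderiv[OF G.left_translation_mdifferentiable]])
  have D: "bounded_linear ?D"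
    using diff i k has_derivative_bounded_linear
    unfolding differentiable_along_def frechet_derivative_works by blast
  have stationary: "?D w + ?\<alpha> (inf_rep (rep P) (lexp P) \<eta> (d_obst P i ?\<alpha>))
      + \<mu> k i ((1 / tstep P) *\<^sub>R ?out (- \<eta>) - w) + \<mu> (k - 1) i ((1 / tstep P) *\<^sub>R ?into \<eta>)
      + (\<Sum>l\<in>agents P. DK l (?T \<eta>)) = 0" (is "?S w \<eta> = 0") for w \<eta>
  proof -
    obtain \<gamma> \<delta> where \<gamma>: "\<gamma> 0 = g k i" "\<delta> > 0" "map_of_class smooth_on flat_atlas (atl P) \<gamma> {-\<delta><..<\<delta>}"
      "has_mderiv flat_atlas (atl P) \<gamma> 0 (\<lambda>s. s *\<^sub>R ?T \<eta>)"
      by (rule exists_smooth_curve[OF G.atlas])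
    \<comment> \<open>The action along this variation has both the computed derivative and, by
      stationarity, derivative zero.\<close>
    have "tstep P * ?S w \<eta> = 0"
      by (rule DERIV_unique[OF action_derivative[OF std diff feas i k \<gamma>(1,4) K[rule_format]]
            stat[rule_format, OF single_agent_variation[where \<gamma> = \<gamma> and g = g, OF G.atlas i k \<gamma>(1,2,3)]]])
    then show ?thesis
      using h by simp
  qed
  \<comment> \<open>Subtracting the identity at \<open>(0, 0)\<close> from that at
    \<open>(w, 0)\<close> removes the terms in \<open>\<eta>\<close> without evaluating
    them.\<close>
  have "\<mu> k i w = ?D w" for w
    using stationary[of w 0] stationary[of 0 0] linear_simps(3)[OF D] by (simp add: blinfun.diff_right)
  then show ?cost
    unfolding d_cost_def by (intro blinfun_eqI) (simp add: bounded_linear_Blinfun_apply[OF D])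
  show ?momentum
  proof (rule blinfun_eqI)
    fix \<eta>
    have "left_pullback P (g k i) (Blinfun (DK l)) \<eta> = DK l (?T \<eta>)" if "l \<in> agents P" for l
      unfolding left_pullback_def dual_map_apply[OF T]
      by (simp add: bounded_linear_Blinfun_apply[OF has_mderiv_bounded_linear[OF K[rule_format, OF that]]])
    then have coll: "(\<Sum>l\<in>agents P. left_pullback P (g k i) (Blinfun (DK l)) \<eta>) = (\<Sum>l\<in>agents P. DK l (?T \<eta>))"
      by (intro sum.cong refl)
    \<comment> \<open>Multiplication by the step size clears \<open>1 / tstep P\<close> from the
      constraint terms and leaves it on the potentials.\<close>
    have "tstep P * ?S 0 \<eta> = tstep P * ?\<alpha> (inf_rep (rep P) (lexp P) \<eta> (d_obst P i ?\<alpha>))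
        - \<mu> k i (?out \<eta>) + \<mu> (k - 1) i (?into \<eta>) + tstep P * (\<Sum>l\<in>agents P. DK l (?T \<eta>))"
      using h by (simp only: linear_simps(3)[OF D] linear_simps(4)[OF out] diff_zero add_0
          blinfun.scaleR_right blinfun.minus_right distrib_left) simp
    moreover have "tstep P * ?S 0 \<eta> = 0"
      by (simp only: stationary mult_zero_right)
    ultimately show "retr_pullback P (tstep P *\<^sub>R u k i) (\<mu> k i) \<eta> =
      (retr_pullback P (- (tstep P *\<^sub>R u (k - 1) i)) (\<mu> (k - 1) i)
      + momentum_map (rep P) (lexp P) (tstep P *\<^sub>R d_obst P i ?\<alpha>) ?\<alpha>
      + tstep P *\<^sub>R (\<Sum>l\<in>agents P. left_pullback P (g k i) (Blinfun (DK l)))) \<eta>"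
      unfolding retr_pullback_def blinfun.add_left blinfun.scaleR_left blinfun.sum_left coll
        dual_map_apply[OF out] dual_map_apply[OF into] momentum_map_apply[OF lie exp rep]
        inf_rep_scaleR[OF lie exp rep] blinfun.scaleR_right real_scaleR_def
      by linarith
  qed
qed

text \<open>The collision force on the first agent in the pinned problem.\<close>

lemma left_pullback_zero: "left_pullback P a (Blinfun (\<lambda>_. 0)) = 0"
  by (simp add: left_pullback_def dual_map_def zero_blinfun.abs_eq[symmetric])

text \<open>The factor \<open>\<Theta>\<close> belongs to the reduced Lagrangian, whose pinned
  collision potentials are blind to the first agent; for the unpinned Lagrangian every agent carries
  a collision term. The potentials being differentiable almost everywhere, differentiability along
  the trajectory is assumed separately.\<close>

theorem theorem5p4:
  fixes P :: "('g::{metric_space, second_countable_topology}, 'e::euclidean_space,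
      'v::euclidean_space) control_problem"
    and g :: "nat \<Rightarrow> nat \<Rightarrow> 'g" and u :: "nat \<Rightarrow> nat \<Rightarrow> 'e"
    and \<mu> :: "nat \<Rightarrow> nat \<Rightarrow> 'e \<Rightarrow>\<^sub>L real"
    and h :: real and abar :: "nat \<Rightarrow> nat \<Rightarrow> 'v \<Rightarrow>\<^sub>L real" and \<Theta> :: "nat \<Rightarrow> real"
  assumes "standing_assumptions P"
    and "differentiable_along P g u"
    and "h = tstep P"
    and "abar = (\<lambda>k. advected P (g k))"
    and "\<Theta> = (\<lambda>i. if i = 1 then 0 else 1)"
  shows
    "(reduced_normal_extremum P g u \<mu> \<and>
       coll_differentiable_along P {2..nag P} (\<lambda>k. pin_first P (g k)) \<longrightarrow>
     (\<forall>i\<in>agents P.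
        abar 0 i = dual_rep (rep P) (g 0 i) (alpha0 P i) \<and>
        (\<forall>k\<in>{1..nsteps P - 1}.
           g (k + 1) i = g k i \<otimes>\<^bsub>grp P\<^esub> retr P (h *\<^sub>R u k i) \<and>
           retr_pullback P (h *\<^sub>R u k i) (\<mu> k i) =
             retr_pullback P (- (h *\<^sub>R u (k - 1) i)) (\<mu> (k - 1) i)
             + momentum_map (rep P) (lexp P) (h *\<^sub>R d_obst P i (abar k i)) (abar k i)
             + (h * \<Theta> i) *\<^sub>R (\<Sum>l\<in>agents P.
                 left_pullback P (g k i) (d_coll P l i (pin_first P (g k)))) \<and>
           \<mu> k i = d_cost P i (u k i) \<and>
           abar (k + 1) i = dual_rep (rep P) (retr P (h *\<^sub>R u k i)) (abar k i)))) \<and>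
     (normal_extremum P g u \<mu> \<and> coll_differentiable_along P (agents P) g \<longrightarrow>
     (\<forall>i\<in>agents P.
        abar 0 i = dual_rep (rep P) (g 0 i) (alpha0 P i) \<and>
        (\<forall>k\<in>{1..nsteps P - 1}.
           g (k + 1) i = g k i \<otimes>\<^bsub>grp P\<^esub> retr P (h *\<^sub>R u k i) \<and>
           retr_pullback P (h *\<^sub>R u k i) (\<mu> k i) =
             retr_pullback P (- (h *\<^sub>R u (k - 1) i)) (\<mu> (k - 1) i)
             + momentum_map (rep P) (lexp P) (h *\<^sub>R d_obst P i (abar k i)) (abar k i)
             + h *\<^sub>R (\<Sum>l\<in>agents P. left_pullback P (g k i) (d_coll P l i (g k))) \<and>
           \<mu> k i = d_cost P i (u k i) \<and>
           abar (k + 1) i = dual_rep (rep P) (retr P (h *\<^sub>R u k i)) (abar k i))))"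
proof -
  have rep: "left_representation (grp P) (atl P) (rep P)"
    using assms(1) unfolding standing_assumptions_def by blast
  have kinematics: "g (k + 1) i = g k i \<otimes>\<^bsub>grp P\<^esub> retr P (h *\<^sub>R u k i)"
      "abar (k + 1) i = dual_rep (rep P) (retr P (h *\<^sub>R u k i)) (abar k i)"
    if "feasible P g u" "i \<in> agents P" "k \<in> {1..nsteps P - 1}" for i k
  proof -
    have "k < nsteps P"
      using that(3) by auto
    then show "g (k + 1) i = g k i \<otimes>\<^bsub>grp P\<^esub> retr P (h *\<^sub>R u k i)"
      using that(1,2) unfolding feasible_def assms(3) by simp
    then show "abar (k + 1) i = dual_rep (rep P) (retr P (h *\<^sub>R u k i)) (abar k i)"
      by (simp add: assms(4) advected_def dual_rep_mult[OF rep])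
  qed
  have initial: "abar 0 i = dual_rep (rep P) (g 0 i) (alpha0 P i)" for i
    by (simp add: assms(4) advected_def)
  have reduced: "\<mu> k i = d_cost P i (u k i) \<and>
      retr_pullback P (h *\<^sub>R u k i) (\<mu> k i) =
        retr_pullback P (- (h *\<^sub>R u (k - 1) i)) (\<mu> (k - 1) i)
        + momentum_map (rep P) (lexp P) (h *\<^sub>R d_obst P i (abar k i)) (abar k i)
        + (h * \<Theta> i) *\<^sub>R (\<Sum>l\<in>agents P. left_pullback P (g k i) (d_coll P l i (pin_first P (g k))))"
    if ext: "reduced_normal_extremum P g u \<mu>"
      and coll: "coll_differentiable_along P {2..nag P} (\<lambda>k. pin_first P (g k))"
      and i: "i \<in> agents P" and k: "k \<in> {1..nsteps P - 1}" for i k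
  proof -
    have k': "k \<in> {1..<nsteps P}"
      using k by auto
    have feas: "feasible P g u"
      and stat: "\<forall>gv uv. variation P g u gv uv \<longrightarrow>
        ((\<lambda>\<epsilon>. action P (\<lambda>l q. coll_total P l (pin_first P q)) \<mu> (gv \<epsilon>) (uv \<epsilon>)) has_real_derivative 0) (at 0)"
      using ext by (simp_all add: reduced_normal_extremum_def sum_reduced_aug_lagrangian)
    note equations = stationary_equations[OF assms(1,2) feas stat i k']
    show ?thesis
    \<comment> \<open>Variations of the first agent leave the pinned configuration fixed, so its
      collision derivative is zero, in agreement with \<open>\<Theta> 1 = 0\<close>.\<close>
    proof (cases "i = 1")
      case True
      have "pin_first P ((g k)(i := x)) = pin_first P (g k)" for x
        by (simp add: pin_first_def True)
      then show ?thesis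
        using equations[of "\<lambda>_ _. 0"]
        by (simp add: has_mderiv_const left_pullback_zero assms(3,4,5) True)
    next
      case False
      then have "i \<in> {2..nag P}"
        using i by auto
      \<comment> \<open>For the other agents pinning commutes with the update and keeps their
        position, so the covector is based at \<open>g k i\<close>, where
        \<open>left_pullback\<close> expects it.\<close>
      have pin: "pin_first P ((g k)(i := x)) = (pin_first P (g k))(i := x)" "pin_first P (g k) i = g k i" for x
        using False by (auto simp: pin_first_def)
      have "\<forall>l\<in>agents P.
        has_mderiv (atl P) flat_atlas (\<lambda>x. coll_total P l (pin_first P ((g k)(i := x)))) (g k i)
          (mderiv (atl P) flat_atlas (\<lambda>x. coll_total P l ((pin_first P (g k))(i := x))) (pin_first P (g k) i))"
        using coll \<open>i \<in> {2..nag P}\<close> k' mdifferentiable_has_mderiv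
        unfolding coll_differentiable_along_def pin by (metis pin(2))
      from equations[OF this] show ?thesis
        using False by (simp add: d_coll_def assms(3,4,5))
    qed
  qed
  have unreduced: "\<mu> k i = d_cost P i (u k i) \<and>
      retr_pullback P (h *\<^sub>R u k i) (\<mu> k i) =
        retr_pullback P (- (h *\<^sub>R u (k - 1) i)) (\<mu> (k - 1) i)
        + momentum_map (rep P) (lexp P) (h *\<^sub>R d_obst P i (abar k i)) (abar k i)
        + h *\<^sub>R (\<Sum>l\<in>agents P. left_pullback P (g k i) (d_coll P l i (g k)))"
    if ext: "normal_extremum P g u \<mu>" and coll: "coll_differentiable_along P (agents P) g"
      and i: "i \<in> agents P" and k: "k \<in> {1..nsteps P - 1}" for i k
  proof -
    have k': "k \<in> {1..<nsteps P}"
      using k by auto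
    have feas: "feasible P g u"
      and stat: "\<forall>gv uv. variation P g u gv uv \<longrightarrow>
        ((\<lambda>\<epsilon>. action P (coll_total P) \<mu> (gv \<epsilon>) (uv \<epsilon>)) has_real_derivative 0) (at 0)"
      using ext by (simp_all add: normal_extremum_def sum_aug_lagrangian[OF assms(1)])
    have "\<forall>l\<in>agents P. has_mderiv (atl P) flat_atlas (\<lambda>x. coll_total P l ((g k)(i := x))) (g k i)
        (mderiv (atl P) flat_atlas (\<lambda>x. coll_total P l ((g k)(i := x))) (g k i))"
      using coll i k' unfolding coll_differentiable_along_def
      by (blast intro: mdifferentiable_has_mderiv)
    from stationary_equations[OF assms(1,2) feas stat i k' this] show ?thesis
      by (simp add: d_coll_def assms(3,4))
  qed
  have "feasible P g u" if "reduced_normal_extremum P g u \<mu> \<or> normal_extremum P g u \<mu>"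
    using that by (auto simp: reduced_normal_extremum_def normal_extremum_def)
  then show ?thesis
    using initial kinematics reduced unreduced by (intro conjI impI ballI) blast+
qed

end
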